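(* Reachability for monogenic affine $\mathbb Z$-VASS is undecidable. Moreover, there exists a fixed monogenic affine $\mathbb Z$-VASS $\mathcal V=(d,Q,T)$ such that the problem of deciding, given configurations $p(\mathbf u),q(\mathbf v)$ of $\mathcal V$, whether $p(\mathbf u)\xrightarrow{*}q(\mathbf v)$, is undecidable.
   Context: An affine $\mathbb Z$-VASS is $\mathcal V=(d,Q,T)$ with $Q$ finite and $T\subseteq Q\times\mathbb Z^{d\times d}\times\mathbb Z^d\times Q$ finite; configurations are $q(\mathbf v)\in Q\times\mathbb Z^d$; $p(\mathbf u)\xrightarrow{t}q(\mathbf v)$ iff $t=(p,A,\mathbf b,q)\in T$ and $\mathbf v=A\mathbf u+\mathbf b$; $\xrightarrow{*}$ is the reflexive-transitive closure of the union of these relations. An affine $\mathbb Z$-VASS is monogenic if there is a single matrix $A\in\mathbb N^{d\times d}$ such that every transition matrix of $\mathcal V$ belongs to the monoid $\{A^n:n\in\mathbb N\}$ generated by $A$ (with $A^0=I$). Reachability for monogenic affine $\mathbb Z$-VASS is the problem: given a monogenic affine $\mathbb Z$-VASS and two configurations $p(\mathbf u),q(\mathbf v)$, decide whether $p(\mathbf u)\xrightarrow{*}q(\mathbf v)$. *)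

theory Defs
  imports "Jordan_Normal_Form.Matrix" "HOL-Library.Nat_Bijection"
begin

section \<open>Affine integer vector addition systems with states\<close>

record 'q affine_vass =
  vass_dim :: nat
  vass_states :: "'q set"
  vass_trans :: "('q \<times> int mat \<times> int vec \<times> 'q) set"

type_synonym 'q config = "'q \<times> int vec"

definition affine_zvass :: "'q affine_vass \<Rightarrow> bool" where
  "affine_zvass V \<longleftrightarrow>
     finite (vass_states V) \<and> finite (vass_trans V) \<and>
     vass_trans V \<subseteq> vass_states V \<times> carrier_mat (vass_dim V) (vass_dim V)
                      \<times> carrier_vec (vass_dim V) \<times> vass_states V"

definition configs :: "'q affine_vass \<Rightarrow> 'q config set" where
  "configs V = vass_states V \<times> carrier_vec (vass_dim V)"

definition trans_rel ::
  "'q affine_vass \<Rightarrow> 'q \<times> int mat \<times> int vec \<times> 'q \<Rightarrow> ('q config \<times> 'q config) set" where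
  "trans_rel V t = {((p, u), (q, v)) | p u q v A b.
     (p, u) \<in> configs V \<and> (q, v) \<in> configs V \<and> t = (p, A, b, q) \<and> v = A *\<^sub>v u + b}"

definition step_rel :: "'q affine_vass \<Rightarrow> ('q config \<times> 'q config) set" where
  "step_rel V = (\<Union>t \<in> vass_trans V. trans_rel V t)"

definition reaches :: "'q affine_vass \<Rightarrow> 'q config \<Rightarrow> 'q config \<Rightarrow> bool" where
  "reaches V c c' \<longleftrightarrow> (c, c') \<in> (step_rel V)\<^sup>*"

definition monogenic :: "'q affine_vass \<Rightarrow> bool" where
  "monogenic V \<longleftrightarrow>
     (\<exists>A :: nat mat. A \<in> carrier_mat (vass_dim V) (vass_dim V) \<and>
        (\<forall>(p, M, b, q) \<in> vass_trans V. \<exists>n. M = map_mat int (A ^\<^sub>m n)))"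


section \<open>Decidability via partial recursive functions\<close>

datatype recf =
    Zero
  | Succ
  | Proj nat
  | Comp recf "recf list"
  | PrimRec recf recf
  | Mu recf

text \<open>\<open>rec_eval f xs y\<close> states that \<open>f\<close> is defined on \<open>xs\<close> with value \<open>y\<close>. Composition is
  strict, and \<open>Mu f\<close> is defined only if \<open>f\<close> is defined at all arguments below the least zero.
  Arities are not tracked: a term denotes a partial recursive function of each arity.\<close>

inductive rec_eval :: "recf \<Rightarrow> nat list \<Rightarrow> nat \<Rightarrow> bool" where
  zero: "rec_eval Zero xs 0"
| succ: "rec_eval Succ (x # xs) (Suc x)"
| proj: "i < length xs \<Longrightarrow> rec_eval (Proj i) xs (xs ! i)"
| comp: "list_all2 (\<lambda>g y. rec_eval g xs y) gs ys \<Longrightarrow> rec_eval f ys z \<Longrightarrow>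
         rec_eval (Comp f gs) xs z"
| prim_rec_0: "rec_eval f xs y \<Longrightarrow> rec_eval (PrimRec f g) (0 # xs) y"
| prim_rec_Suc: "rec_eval (PrimRec f g) (n # xs) y \<Longrightarrow> rec_eval g (n # y # xs) z \<Longrightarrow>
         rec_eval (PrimRec f g) (Suc n # xs) z"
| mu: "rec_eval f (n # xs) 0 \<Longrightarrow> (\<forall>m<n. \<exists>y. rec_eval f (m # xs) (Suc y)) \<Longrightarrow>
         rec_eval (Mu f) xs n"

inductive_cases rec_eval_elims:
  "rec_eval Zero xs z" "rec_eval Succ xs z" "rec_eval (Proj i) xs z" "rec_eval (Comp f gs) xs z"
  "rec_eval (PrimRec f g) (0 # xs) z" "rec_eval (PrimRec f g) (Suc n # xs) z" "rec_eval (Mu f) xs z"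

lemma rec_eval_functional: "rec_eval f xs y \<Longrightarrow> rec_eval f xs z \<Longrightarrow> y = z"
proof (induction arbitrary: z rule: rec_eval.induct)
  case (comp xs gs ys f w)
  from comp.prems obtain ys' where ys': "list_all2 (\<lambda>g y. rec_eval g xs y) gs ys'"
    and z: "rec_eval f ys' z" by (blast elim: rec_eval_elims)
  have "ys = ys'"
    using comp.IH(1) ys' by (auto simp: list_all2_conv_all_nth intro!: nth_equalityI)
  with z comp.IH(2) show ?case by simp
next
  case (prim_rec_Suc f g n xs y w)
  from prim_rec_Suc.prems obtain y' where
    "rec_eval (PrimRec f g) (n # xs) y'" "rec_eval g (n # y' # xs) z"
    by (blast elim: rec_eval_elims)
  with prim_rec_Suc.IH show ?case by metis
next
  case (mu f n xs)
  from mu.prems have z: "rec_eval f (z # xs) 0" "\<forall>m<z. \<exists>y. rec_eval f (m # xs) (Suc y)"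
    by (auto elim!: rec_eval_elims(7))
  show ?case
  proof (rule ccontr)
    assume "n \<noteq> z"
    then consider "n < z" | "z < n" by linarith
    then show False
    proof cases
      case 1
      with z(2) obtain y where "rec_eval f (n # xs) (Suc y)" by blast
      with mu.IH(1) show False by fastforce
    next
      case 2
      with mu.IH(2) z(1) show False by blast
    qed
  qed
qed (blast elim: rec_eval_elims)+

text \<open>The decision problem with instance set \<open>I\<close>, presented to the algorithm through the encoding
  \<open>enc\<close>, and yes-instances \<open>{x \<in> I. P x}\<close>. It is a promise problem: nothing is required of the
  algorithm on numbers that do not encode an instance.\<close>

definition decidable_problem :: "('a \<Rightarrow> nat) \<Rightarrow> 'a set \<Rightarrow> ('a \<Rightarrow> bool) \<Rightarrow> bool" where
  "decidable_problem enc I P \<longleftrightarrow>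
     (\<exists>f. \<forall>x \<in> I. rec_eval f [enc x] (if P x then 1 else 0))"


section \<open>Encoding of instances\<close>

definition encode_vec :: "int vec \<Rightarrow> nat" where
  "encode_vec v = list_encode (map int_encode (list_of_vec v))"

definition encode_mat :: "int mat \<Rightarrow> nat" where
  "encode_mat A = list_encode (map (\<lambda>r. list_encode (map int_encode r)) (mat_to_list A))"

definition encode_trans :: "nat \<times> int mat \<times> int vec \<times> nat \<Rightarrow> nat" where
  "encode_trans = (\<lambda>(p, A, b, q). list_encode [p, encode_mat A, encode_vec b, q])"

definition encode_vass :: "nat affine_vass \<Rightarrow> nat" where
  "encode_vass V = list_encode
     [vass_dim V, set_encode (vass_states V), set_encode (encode_trans ` vass_trans V)]"

definition encode_config :: "nat config \<Rightarrow> nat" where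
  "encode_config = (\<lambda>(q, v). prod_encode (q, encode_vec v))"

definition encode_config_pair :: "nat config \<times> nat config \<Rightarrow> nat" where
  "encode_config_pair = (\<lambda>(c, c'). prod_encode (encode_config c, encode_config c'))"

definition encode_instance :: "nat affine_vass \<times> nat config \<times> nat config \<Rightarrow> nat" where
  "encode_instance = (\<lambda>(V, cs). prod_encode (encode_vass V, encode_config_pair cs))"

definition monogenic_instances :: "(nat affine_vass \<times> nat config \<times> nat config) set" where
  "monogenic_instances =
     {(V, c, c'). affine_zvass V \<and> monogenic V \<and> c \<in> configs V \<and> c' \<in> configs V}"

text \<open>The encodings are injective on instances, so undecidability cannot stem from distinct
  instances sharing a code.\<close>

lemma encode_vec_inj: "encode_vec u = encode_vec v \<Longrightarrow> u = v"
proof -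
  assume "encode_vec u = encode_vec v"
  then have "list_of_vec u = list_of_vec v"
    by (auto simp: encode_vec_def list_encode_eq dest: map_injective[OF _ inj_int_encode])
  then show "u = v" by (metis vec_list)
qed

lemma encode_mat_inj:
  assumes "A \<in> carrier_mat d d" "B \<in> carrier_mat d d" "encode_mat A = encode_mat B"
  shows "A = B"
proof -
  have "inj (\<lambda>r. list_encode (map int_encode r))"
    by (auto intro!: injI simp: list_encode_eq dest: map_injective[OF _ inj_int_encode])
  with assms(3) have "mat_to_list A = mat_to_list B"
    by (auto simp: encode_mat_def list_encode_eq dest: map_injective)
  with assms(1,2) show ?thesis by (intro eq_matI) (auto simp: mat_to_list_def)
qed

lemma encode_vass_inj:
  assumes "affine_zvass V" "affine_zvass W" "encode_vass V = encode_vass W"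
  shows "V = (W :: nat affine_vass)"
proof -
  from assms have d: "vass_dim V = vass_dim W"
    and Q: "vass_states V = vass_states W"
    and T: "encode_trans ` vass_trans V = encode_trans ` vass_trans W"
    by (auto simp: encode_vass_def list_encode_eq affine_zvass_def set_encode_eq)
  have "inj_on encode_trans (vass_trans V \<union> vass_trans W)"
  proof (rule inj_onI)
    fix s t assume *: "s \<in> vass_trans V \<union> vass_trans W" "t \<in> vass_trans V \<union> vass_trans W"
      "encode_trans s = encode_trans t"
    obtain p A b q p' A' b' q' where s: "s = (p, A, b, q)" and t: "t = (p', A', b', q')"
      by (metis prod_cases4)
    have "A \<in> carrier_mat (vass_dim V) (vass_dim V)" "A' \<in> carrier_mat (vass_dim V) (vass_dim V)"
      using * assms(1,2) d unfolding s t affine_zvass_def by auto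
    with *(3) show "s = t"
      unfolding s t by (auto simp: encode_trans_def list_encode_eq
          dest: encode_vec_inj encode_mat_inj)
  qed
  with T have "vass_trans V = vass_trans W" by (simp add: inj_on_Un_image_eq_iff)
  with d Q show ?thesis by simp
qed

lemma inj_encode_config_pair: "inj encode_config_pair"
  by (auto intro!: injI simp: encode_config_pair_def encode_config_def prod_encode_eq
      dest: encode_vec_inj)

lemma inj_on_encode_instance: "inj_on encode_instance monogenic_instances"
  by (auto intro!: inj_onI simp: encode_instance_def monogenic_instances_def prod_encode_eq
      dest: encode_vass_inj injD[OF inj_encode_config_pair])

end

theory Submission
  imports Defs
begin

text \<open>The matrix is \<open>diag(k, k, 1)\<close>. A run appends base-\<open>k\<close> digits to two numbers in lockstep, the
  letters of \<open>w\<close> to one and those of \<open>w'\<close> to the other, under the control of a finite automaton. The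
  third entry serves to compare the two at different delays: a run to \<open>0\<close> exists iff
  \<open>0\<dots>0 c w' = w f\<close> as words, for some \<open>f\<close> and some number of leading zeros, where \<open>c\<close> is read off the
  initial vector. This says that an automaton with a queue, initially \<open>0\<dots>0 c\<close>, can read \<open>w\<close> while
  writing \<open>w'\<close>. If a separator marks the end of the queue, each revolution of the queue can perform
  one instruction of a nondeterministic counter machine, the value of a counter being the number
  of occurrences of a letter; the zeros provide the space. A fixed counter machine evaluates all
  partial recursive functions by rewriting stacks of goals coded as numbers, so that a decision
  procedure for reachability would decide whether \<open>f\<close> takes the value \<open>0\<close> on its own code.\<close>

section \<open>Regular expressions over relations\<close>

text \<open>A run on integer vectors can test neither sign nor zero; the only test is the target
  vector. A whole computation therefore has to be verified by one equation between numbers, and the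
  queue equation has this form because it compares all revolutions at once: each part of the word
  written must reappear, one revolution later, as the word read. Equal numbers determine equal words
  only up to leading zeros. Since the initial queue begins with a nonzero letter, this ambiguity can
  only lengthen the initial queue, so a run has as much blank space as it wants without any change
  of the initial vector. The leftover \<open>f\<close> is arbitrary, so a halting computation need
  not clean up. Only the existence of a run matters at every level. Hence values, rules and
  intermediate results may be guessed and checked afterwards, and no machine has to be
  deterministic. Matrix, vectors and control depend on the rewrite rules alone; the input enters
  only through the source vector, which gives undecidability for one fixed system.\<close>

datatype 'a rx = Sym "'a list" | Seq "'a rx" "'a rx" | Alt "'a rx" "'a rx" | Star "'a rx"

primrec den :: "('a \<Rightarrow> ('s \<times> 's) set) \<Rightarrow> 'a rx \<Rightarrow> ('s \<times> 's) set" where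
  "den \<alpha> (Sym as) = (\<Union>a\<in>set as. \<alpha> a)"
| "den \<alpha> (Seq r s) = den \<alpha> r O den \<alpha> s"
| "den \<alpha> (Alt r s) = den \<alpha> r \<union> den \<alpha> s"
| "den \<alpha> (Star r) = (den \<alpha> r)\<^sup>*"

inductive matches :: "'a rx \<Rightarrow> 'a list \<Rightarrow> bool" where
  Sym: "a \<in> set as \<Longrightarrow> matches (Sym as) [a]"
| Seq: "matches r u \<Longrightarrow> matches s v \<Longrightarrow> matches (Seq r s) (u @ v)"
| AltL: "matches r u \<Longrightarrow> matches (Alt r s) u"
| AltR: "matches s u \<Longrightarrow> matches (Alt r s) u"
| Star_Nil: "matches (Star r) []"
| Star_append: "matches r u \<Longrightarrow> matches (Star r) v \<Longrightarrow> matches (Star r) (u @ v)"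

inductive_cases matches_SymE: "matches (Sym as) w"
inductive_cases matches_SeqE: "matches (Seq r s) w"
inductive_cases matches_AltE: "matches (Alt r s) w"

primrec path :: "('a \<Rightarrow> ('s \<times> 's) set) \<Rightarrow> 'a list \<Rightarrow> ('s \<times> 's) set" where
  "path \<alpha> [] = Id"
| "path \<alpha> (a # w) = \<alpha> a O path \<alpha> w"

lemma path_append: "path \<alpha> (u @ v) = path \<alpha> u O path \<alpha> v"
  by (induction u) auto

lemma path_subset_den: "matches r w \<Longrightarrow> path \<alpha> w \<subseteq> den \<alpha> r"
proof (induction rule: matches.induct)
  case (Star_append r u v)
  have "den \<alpha> r O (den \<alpha> r)\<^sup>* \<subseteq> (den \<alpha> r)\<^sup>*"
    by (auto intro: converse_rtrancl_into_rtrancl)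
  moreover have "path \<alpha> (u @ v) \<subseteq> den \<alpha> r O (den \<alpha> r)\<^sup>*"
    using relcomp_mono[OF Star_append.IH] by (simp add: path_append)
  ultimately show ?case by simp
qed (auto simp: path_append)

lemma den_imp_path: "(s, t) \<in> den \<alpha> r \<Longrightarrow> \<exists>w. matches r w \<and> (s, t) \<in> path \<alpha> w"
proof (induction r arbitrary: s t)
  case (Sym as)
  then obtain a where "a \<in> set as" "(s, t) \<in> \<alpha> a" by auto
  then show ?case by (intro exI[of _ "[a]"]) (auto intro: matches.Sym)
next
  case (Seq r1 r2)
  then obtain x where "(s, x) \<in> den \<alpha> r1" "(x, t) \<in> den \<alpha> r2" by auto
  then obtain u v where "matches r1 u" "(s, x) \<in> path \<alpha> u" "matches r2 v" "(x, t) \<in> path \<alpha> v"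
    using Seq.IH by blast
  then show ?case by (intro exI[of _ "u @ v"]) (auto simp: path_append intro: matches.Seq)
next
  case (Alt r1 r2)
  from Alt.prems have "(s, t) \<in> den \<alpha> r1 \<or> (s, t) \<in> den \<alpha> r2" by simp
  with Alt.IH show ?case by (blast intro: matches.AltL matches.AltR)
next
  case (Star r)
  then have "(s, t) \<in> (den \<alpha> r)\<^sup>*" by simp
  then show ?case
  proof (induction rule: converse_rtrancl_induct)
    case base
    show ?case by (intro exI[of _ "[]"]) (auto intro: matches.Star_Nil)
  next
    case (step y z)
    then obtain v u where "matches (Star r) v" "(z, t) \<in> path \<alpha> v" "matches r u" "(y, z) \<in> path \<alpha> u"
      using Star.IH by blast
    then show ?case
      by (intro exI[of _ "u @ v"]) (auto simp: path_append intro: matches.Star_append)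
  qed
qed

lemma den_eq_path: "(s, t) \<in> den \<alpha> r \<longleftrightarrow> (\<exists>w. matches r w \<and> (s, t) \<in> path \<alpha> w)"
  using den_imp_path path_subset_den by fast

section \<open>Transport of denotations along a map\<close>

lemma path_embed:
  assumes "\<And>a s t. (h s, t) \<in> \<alpha> a \<longleftrightarrow> (\<exists>s'. t = h s' \<and> (s, s') \<in> \<beta> a)"
  shows "(h s, t) \<in> path \<alpha> w \<longleftrightarrow> (\<exists>s'. t = h s' \<and> (s, s') \<in> path \<beta> w)"
proof (induction w arbitrary: s)
  case (Cons a w)
  have "(h s, t) \<in> path \<alpha> (a # w) \<longleftrightarrow> (\<exists>s1. (s, s1) \<in> \<beta> a \<and> (h s1, t) \<in> path \<alpha> w)"
    using assms by (auto simp: relcomp_unfold)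
  with Cons.IH show ?case by (auto simp: relcomp_unfold)
qed auto

text \<open>The hypothesis says that steps from the range of \<open>h\<close> stay in it and mirror
  the steps of \<open>\<beta>\<close>. This later replaces vectors of dimension 3 by triples of
  integers.\<close>

lemma den_embed:
  assumes "\<And>a s t. (h s, t) \<in> \<alpha> a \<longleftrightarrow> (\<exists>s'. t = h s' \<and> (s, s') \<in> \<beta> a)"
  shows "(h s, t) \<in> den \<alpha> r \<longleftrightarrow> (\<exists>s'. t = h s' \<and> (s, s') \<in> den \<beta> r)"
  unfolding den_eq_path using path_embed[of h \<alpha> \<beta>, OF assms] by blast

lemma matches_Seq_iff:
  "matches (Seq r s) w \<longleftrightarrow> (\<exists>u v. w = u @ v \<and> matches r u \<and> matches s v)"
  by (blast elim: matches_SeqE intro: matches.Seq)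

lemma matches_Sym_iff: "matches (Sym as) w \<longleftrightarrow> (\<exists>a\<in>set as. w = [a])"
  by (blast elim: matches_SymE intro: matches.Sym)

lemma matches_Star_Sym_iff: "matches (Star (Sym as)) w \<longleftrightarrow> set w \<subseteq> set as"
proof
  show "set w \<subseteq> set as" if "matches (Star (Sym as)) w"
    using that by (induction "Star (Sym as)" w rule: matches.induct) (auto elim: matches_SymE)
  show "matches (Star (Sym as)) w" if "set w \<subseteq> set as"
    using that
  proof (induction w)
    case (Cons a w)
    then show ?case using matches.Star_append[of "Sym as" "[a]" w] by (simp add: matches.Sym)
  qed (simp add: matches.Star_Nil)
qed

section \<open>Substitution of expressions for letters\<close>

text \<open>\<open>Sym []\<close> matches no word, so it is the neutral element that closes the
  alternation.\<close>

primrec subst :: "('a \<Rightarrow> 'b rx) \<Rightarrow> 'a rx \<Rightarrow> 'b rx" where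
  "subst \<sigma> (Sym as) = foldr (\<lambda>a. Alt (\<sigma> a)) as (Sym [])"
| "subst \<sigma> (Seq r s) = Seq (subst \<sigma> r) (subst \<sigma> s)"
| "subst \<sigma> (Alt r s) = Alt (subst \<sigma> r) (subst \<sigma> s)"
| "subst \<sigma> (Star r) = Star (subst \<sigma> r)"

lemma matches_subst_intro:
  "matches r w \<Longrightarrow> list_all2 (\<lambda>a. matches (\<sigma> a)) w vs \<Longrightarrow> matches (subst \<sigma> r) (concat vs)"
proof (induction arbitrary: vs rule: matches.induct)
  case (Sym a as)
  then obtain v where vs: "vs = [v]" and v: "matches (\<sigma> a) v"
    by (auto simp: list_all2_Cons1)
  have "matches (foldr (\<lambda>a. Alt (\<sigma> a)) as (Sym [])) v" using Sym(1)
    by (induction as) (auto intro: matches.AltL matches.AltR v)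
  then show ?case by (simp add: vs)
next
  case (Seq r u s v)
  from Seq.prems obtain us vs' where vs: "vs = us @ vs'"
    and us: "list_all2 (\<lambda>a. matches (\<sigma> a)) u us" "list_all2 (\<lambda>a. matches (\<sigma> a)) v vs'"
    by (auto simp: list_all2_append1)
  then show ?case
    using matches.Seq[OF Seq.IH(1)[OF us(1)] Seq.IH(2)[OF us(2)]] by simp
next
  case (Star_append r u v)
  from Star_append.prems obtain us vs' where vs: "vs = us @ vs'"
    and us: "list_all2 (\<lambda>a. matches (\<sigma> a)) u us" "list_all2 (\<lambda>a. matches (\<sigma> a)) v vs'"
    by (auto simp: list_all2_append1)
  then show ?case
    using matches.Star_append[OF Star_append.IH(1)[OF us(1)]] Star_append.IH(2)[OF us(2)] by simp
qed (auto intro: matches.AltL matches.AltR matches.Star_Nil)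

lemma matches_subst_elim:
  assumes "matches (subst \<sigma> r) v"
  shows "\<exists>w vs. matches r w \<and> list_all2 (\<lambda>a. matches (\<sigma> a)) w vs \<and> v = concat vs"
  using assms
proof (induction r arbitrary: v)
  case (Sym as)
  then have "\<exists>a\<in>set as. matches (\<sigma> a) v"
    by (induction as) (auto elim: matches_SymE matches_AltE)
  then obtain a where "a \<in> set as" "matches (\<sigma> a) v" by blast
  then show ?case by (intro exI[of _ "[a]"] exI[of _ "[v]"]) (auto intro: matches.Sym)
next
  case (Seq r1 r2)
  then obtain v1 v2 where v: "v = v1 @ v2" "matches (subst \<sigma> r1) v1" "matches (subst \<sigma> r2) v2"
    by (auto elim: matches_SeqE)
  with Seq.IH obtain w1 vs1 w2 vs2 where "matches r1 w1" "list_all2 (\<lambda>a. matches (\<sigma> a)) w1 vs1"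
     "v1 = concat vs1" "matches r2 w2" "list_all2 (\<lambda>a. matches (\<sigma> a)) w2 vs2" "v2 = concat vs2"
    by metis
  then show ?case
    by (intro exI[of _ "w1 @ w2"] exI[of _ "vs1 @ vs2"])
      (auto simp: v intro: matches.Seq list_all2_appendI)
next
  case (Alt r1 r2)
  from Alt.prems have "matches (subst \<sigma> r1) v \<or> matches (subst \<sigma> r2) v"
    by (auto elim: matches_AltE)
  with Alt.IH show ?case by (blast intro: matches.AltL matches.AltR)
next
  case (Star r)
  from Star.prems have "matches (Star (subst \<sigma> r)) v" by simp
  then show ?case
  proof (induction "Star (subst \<sigma> r)" v rule: matches.induct)
    case Star_Nil
    show ?case by (intro exI[of _ "[]"]) (auto intro: matches.Star_Nil)
  next
    case (Star_append u v)
    from Star.IH[OF Star_append(1)] Star_append(4) obtain w1 vs1 w2 vs2 where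
      "matches r w1" "list_all2 (\<lambda>a. matches (\<sigma> a)) w1 vs1" "u = concat vs1"
      "matches (Star r) w2" "list_all2 (\<lambda>a. matches (\<sigma> a)) w2 vs2" "v = concat vs2" by metis
    then show ?case
      by (intro exI[of _ "w1 @ w2"] exI[of _ "vs1 @ vs2"])
        (auto intro: matches.Star_append list_all2_appendI)
  qed
qed

section \<open>Regular expressions as monogenic systems\<close>

text \<open>The states of the automaton are stacks of expressions still to be executed. Only finitely
  many stacks are reachable, and each edge can be checked on its own against the denotation of
  stacks, so no path ever has to be decomposed.\<close>

primrec edges :: "'a rx \<Rightarrow> 'a rx list \<Rightarrow> ('a rx list \<times> 'a option \<times> 'a rx list) set" where
  "edges (Sym as) K = (\<lambda>a. (Sym as # K, Some a, K)) ` set as"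
| "edges (Seq r s) K = {(Seq r s # K, None, r # s # K)} \<union> edges r (s # K) \<union> edges s K"
| "edges (Alt r s) K = {(Alt r s # K, None, r # K), (Alt r s # K, None, s # K)}
     \<union> edges r K \<union> edges s K"
| "edges (Star r) K = {(Star r # K, None, K), (Star r # K, None, r # Star r # K)}
     \<union> edges r (Star r # K)"

lemma finite_edges: "finite (edges r K)"
  by (induction r arbitrary: K) auto

definition edge_rel ::
  "('a \<Rightarrow> ('s \<times> 's) set) \<Rightarrow> ('q \<times> 'a option \<times> 'q) set \<Rightarrow> (('q \<times> 's) \<times> ('q \<times> 's)) set" where
  "edge_rel \<alpha> E = {((p, s), (q, t)) | p s q t l.
     (p, l, q) \<in> E \<and> (s, t) \<in> (case l of None \<Rightarrow> Id | Some a \<Rightarrow> \<alpha> a)}"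

primrec den_stack :: "('a \<Rightarrow> ('s \<times> 's) set) \<Rightarrow> 'a rx list \<Rightarrow> ('s \<times> 's) set" where
  "den_stack \<alpha> [] = Id"
| "den_stack \<alpha> (r # K) = den \<alpha> r O den_stack \<alpha> K"

text \<open>Read from the end of a run: whatever the target stack can still do after the label, the
  source stack can do as well. Since the empty stack denotes the identity, induction over a run
  ending there bounds the whole run by the denotation of its first stack.\<close>

lemma edges_sound:
  "(p, l, q) \<in> edges r K \<Longrightarrow>
   (case l of None \<Rightarrow> Id | Some a \<Rightarrow> \<alpha> a) O den_stack \<alpha> q \<subseteq> den_stack \<alpha> p"
proof (induction r arbitrary: K)
  case (Star r)
  have 1: "den \<alpha> r O ((den \<alpha> r)\<^sup>* O X) \<subseteq> (den \<alpha> r)\<^sup>* O X" for X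
    by (auto intro: converse_rtrancl_into_rtrancl)
  have 2: "X \<subseteq> (den \<alpha> r)\<^sup>* O X" for X by auto
  from Star.prems consider "p = Star r # K" "l = None" "q = K"
    | "p = Star r # K" "l = None" "q = r # Star r # K" | "(p, l, q) \<in> edges r (Star r # K)"
    by auto
  then show ?case
  proof cases
    case 3
    then show ?thesis by (rule Star.IH)
  qed (simp_all add: 1 2)
next
  case (Seq r s)
  from Seq.prems consider "p = Seq r s # K" "l = None" "q = r # s # K"
    | "(p, l, q) \<in> edges r (s # K)" | "(p, l, q) \<in> edges s K"
    by auto
  then show ?case
  proof cases
    case 1
    then show ?thesis by (simp add: O_assoc)
  next
    case 2
    then show ?thesis by (rule Seq.IH(1))
  next
    case 3
    then show ?thesis by (rule Seq.IH(2))
  qed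
next
  case (Alt r s)
  from Alt.prems consider "p = Alt r s # K" "l = None" "q = r # K"
    | "p = Alt r s # K" "l = None" "q = s # K"
    | "(p, l, q) \<in> edges r K" | "(p, l, q) \<in> edges s K"
    by auto
  then show ?case
  proof cases
    case 3
    then show ?thesis by (rule Alt.IH(1))
  next
    case 4
    then show ?thesis by (rule Alt.IH(2))
  qed auto
next
  case (Sym as)
  then obtain a where "a \<in> set as" "p = Sym as # K" "l = Some a" "q = K" by auto
  then show ?case by (auto intro: relcompI)
qed

lemma edge_rel_mono: "E \<subseteq> F \<Longrightarrow> (edge_rel \<alpha> E)\<^sup>* \<subseteq> (edge_rel \<alpha> F)\<^sup>*"
  unfolding edge_rel_def by (intro rtrancl_mono) blast

lemma edge_rel_None: "(p, None, q) \<in> E \<Longrightarrow> ((p, s), (q, s)) \<in> edge_rel \<alpha> E"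
  unfolding edge_rel_def by force

lemma edges_complete:
  "(s, t) \<in> den \<alpha> r \<Longrightarrow> ((r # K, s), (K, t)) \<in> (edge_rel \<alpha> (edges r K))\<^sup>*"
proof (induction r arbitrary: s t K)
  case (Sym as)
  then obtain a where "a \<in> set as" "(s, t) \<in> \<alpha> a" by auto
  then have "((Sym as # K, s), (K, t)) \<in> edge_rel \<alpha> (edges (Sym as) K)"
    unfolding edge_rel_def by (intro CollectI case_prodI2 exI[of _ "Some a"] exI conjI) auto
  then show ?case by blast
next
  case (Seq r1 r2)
  let ?E = "edges (Seq r1 r2) K"
  from Seq.prems obtain x where x: "(s, x) \<in> den \<alpha> r1" "(x, t) \<in> den \<alpha> r2" by auto
  have "((Seq r1 r2 # K, s), (r1 # r2 # K, s)) \<in> edge_rel \<alpha> ?E"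
    by (rule edge_rel_None) simp
  moreover have "((r1 # r2 # K, s), (r2 # K, x)) \<in> (edge_rel \<alpha> ?E)\<^sup>*"
    by (rule subsetD[OF edge_rel_mono Seq.IH(1)[OF x(1)]]) auto
  moreover have "((r2 # K, x), (K, t)) \<in> (edge_rel \<alpha> ?E)\<^sup>*"
    by (rule subsetD[OF edge_rel_mono Seq.IH(2)[OF x(2)]]) auto
  ultimately show ?case
    by (meson converse_rtrancl_into_rtrancl rtrancl_trans)
next
  case (Alt r1 r2)
  let ?E = "edges (Alt r1 r2) K"
  from Alt.prems consider "(s, t) \<in> den \<alpha> r1" | "(s, t) \<in> den \<alpha> r2" by auto
  then show ?case
  proof cases
    case 1
    have "((Alt r1 r2 # K, s), (r1 # K, s)) \<in> edge_rel \<alpha> ?E"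
      by (rule edge_rel_None) simp
    moreover have "((r1 # K, s), (K, t)) \<in> (edge_rel \<alpha> ?E)\<^sup>*"
      by (rule subsetD[OF edge_rel_mono Alt.IH(1)[OF 1]]) auto
    ultimately show ?thesis by (meson converse_rtrancl_into_rtrancl)
  next
    case 2
    have "((Alt r1 r2 # K, s), (r2 # K, s)) \<in> edge_rel \<alpha> ?E"
      by (rule edge_rel_None) simp
    moreover have "((r2 # K, s), (K, t)) \<in> (edge_rel \<alpha> ?E)\<^sup>*"
      by (rule subsetD[OF edge_rel_mono Alt.IH(2)[OF 2]]) auto
    ultimately show ?thesis by (meson converse_rtrancl_into_rtrancl)
  qed
next
  case (Star r)
  let ?E = "edges (Star r) K"
  from Star.prems have "(s, t) \<in> (den \<alpha> r)\<^sup>*" by simp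
  then show ?case
  proof (induction rule: converse_rtrancl_induct)
    case base
    have "((Star r # K, t), (K, t)) \<in> edge_rel \<alpha> ?E"
      by (rule edge_rel_None) simp
    then show ?case by blast
  next
    case (step y z)
    have "((Star r # K, y), (r # Star r # K, y)) \<in> edge_rel \<alpha> ?E"
      by (rule edge_rel_None) simp
    moreover have "((r # Star r # K, y), (Star r # K, z)) \<in> (edge_rel \<alpha> ?E)\<^sup>*"
      by (rule subsetD[OF edge_rel_mono Star.IH[OF step(1)]]) auto
    ultimately show ?case
      using step.IH by (meson converse_rtrancl_into_rtrancl rtrancl_trans)
  qed
qed

lemma edges_correct:
  "(([r], s), ([], t)) \<in> (edge_rel \<alpha> (edges r []))\<^sup>* \<longleftrightarrow> (s, t) \<in> den \<alpha> r"
proof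
  have "(snd c, t) \<in> den_stack \<alpha> (fst c)"
    if "(c, ([], t)) \<in> (edge_rel \<alpha> (edges r []))\<^sup>*" for c
    using that
  proof (induction rule: converse_rtrancl_induct)
    case (step c d)
    then show ?case using edges_sound by (fastforce simp: edge_rel_def)
  qed simp
  then show "(s, t) \<in> den \<alpha> r" if "(([r], s), ([], t)) \<in> (edge_rel \<alpha> (edges r []))\<^sup>*"
    using that by fastforce
qed (rule edges_complete)

section \<open>From automata to affine systems\<close>

definition affine_rel :: "nat \<Rightarrow> nat mat \<Rightarrow> nat \<times> int vec \<Rightarrow> (int vec \<times> int vec) set" where
  "affine_rel d A = (\<lambda>(n, b).
     {(u, v). u \<in> carrier_vec d \<and> v = map_mat int (A ^\<^sub>m n) *\<^sub>v u + b})"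

text \<open>Renames states: stacks of expressions become natural numbers, as the encoding of
  instances demands. Membership of the data in \<open>D\<close> is asked only of the source, because
  every step of \<open>S\<close> ends in \<open>D\<close>.\<close>

lemma rtrancl_map_prod_inj:
  assumes inj: "inj_on f Q" and R: "R \<subseteq> (Q \<times> UNIV) \<times> (Q \<times> UNIV)"
    and S: "\<And>p s q t. p \<in> Q \<Longrightarrow> q \<in> Q \<Longrightarrow> s \<in> D \<Longrightarrow>
       ((f p, s), (f q, t)) \<in> S \<longleftrightarrow> ((p, s), (q, t)) \<in> R"
    and S_sub: "S \<subseteq> (f ` Q \<times> D) \<times> (f ` Q \<times> D)"
    and pq: "p \<in> Q" "q \<in> Q" "s \<in> D"
  shows "((f p, s), (f q, t)) \<in> S\<^sup>* \<longleftrightarrow> ((p, s), (q, t)) \<in> R\<^sup>*"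
proof
  have "\<exists>p\<in>Q. fst c = f p \<and> ((p, snd c), (q, t)) \<in> R\<^sup>*"
    if "(c, (f q, t)) \<in> S\<^sup>*" for c
    using that
  proof (induction rule: converse_rtrancl_induct)
    case base
    show ?case using pq by auto
  next
    case (step c d)
    obtain c1 s1 d1 t1 where cd: "c = (c1, s1)" "d = (d1, t1)" by fastforce
    from step(3) obtain d2 where d2: "d2 \<in> Q" "d1 = f d2" "((d2, t1), (q, t)) \<in> R\<^sup>*"
      using cd by auto
    from step(1) S_sub obtain c2 where c2: "c2 \<in> Q" "c1 = f c2" "s1 \<in> D" using cd by auto
    have "((c2, s1), (d2, t1)) \<in> R" using S[of c2 d2 s1 t1] step(1) c2 d2 cd by auto
    with d2 c2 cd show ?case by (metis converse_rtrancl_into_rtrancl fst_conv snd_conv)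
  qed
  then show "((p, s), (q, t)) \<in> R\<^sup>*" if "((f p, s), (f q, t)) \<in> S\<^sup>*"
    using that inj pq by (metis fst_conv inj_onD snd_conv)
next
  have "snd c \<in> D \<Longrightarrow> fst c \<in> Q \<Longrightarrow> ((f (fst c), snd c), (f q, t)) \<in> S\<^sup>*"
    if "(c, (q, t)) \<in> R\<^sup>*" for c
    using that
  proof (induction rule: converse_rtrancl_induct)
    case (step c d)
    obtain c1 s1 d1 t1 where cd: "c = (c1, s1)" "d = (d1, t1)" by fastforce
    have Q: "c1 \<in> Q" "d1 \<in> Q" using step(1) R cd by auto
    with step cd have 1: "((f c1, s1), (f d1, t1)) \<in> S" using S[of c1 d1 s1 t1] by auto
    then have "t1 \<in> D" using S_sub by auto
    with step.IH Q cd 1 show ?case by (auto intro: converse_rtrancl_into_rtrancl)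
  qed auto
  then show "((f p, s), (f q, t)) \<in> S\<^sup>*" if "((p, s), (q, t)) \<in> R\<^sup>*"
    using that pq by fastforce
qed

text \<open>A letter carries an exponent rather than a matrix, so every transition matrix is a power
  of \<open>A\<close> by construction.\<close>

lemma monogenic_of_rx:
  fixes r :: "'a rx" and lab :: "'a \<Rightarrow> nat \<times> int vec"
  assumes A: "A \<in> carrier_mat d d" and lab: "\<And>a. snd (lab a) \<in> carrier_vec d"
  obtains V :: "nat affine_vass" and p q where "affine_zvass V" "monogenic V" "vass_dim V = d"
    "p \<in> vass_states V" "q \<in> vass_states V"
    "\<And>u v. u \<in> carrier_vec d \<Longrightarrow>
       reaches V (p, u) (q, v) \<longleftrightarrow> (u, v) \<in> den (\<lambda>a. affine_rel d A (lab a)) r"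
proof -
  define E where "E = edges r []"
  define Q where "Q = {[r], []} \<union> fst ` E \<union> (snd \<circ> snd) ` E"
  \<comment> \<open>A silent edge becomes the identity map: exponent 0 and the zero vector.\<close>
  define lb where "lb l = (case l of None \<Rightarrow> (0, 0\<^sub>v d) | Some a \<Rightarrow> lab a)" for l
  have finE: "finite E" by (simp add: E_def finite_edges)
  then have "finite Q" by (simp add: Q_def)
  then obtain f :: "'a rx list \<Rightarrow> nat" where f: "inj_on f Q"
    using finite_imp_inj_to_nat_seg by metis
  define tr where "tr = (\<lambda>(p, l, q). (f p, map_mat int (A ^\<^sub>m fst (lb l)), snd (lb l), f q))"
  define V where "V = \<lparr>vass_dim = d, vass_states = f ` Q, vass_trans = tr ` E\<rparr>"
  let ?\<alpha> = "\<lambda>a. affine_rel d A (lab a)"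
  have lb: "snd (lb l) \<in> carrier_vec d" for l
    using lab by (cases l) (auto simp: lb_def)
  have E_sub: "p \<in> Q \<and> q \<in> Q" if "(p, l, q) \<in> E" for p l q
    using that unfolding Q_def by force
  have map_A: "map_mat int (A ^\<^sub>m n) \<in> carrier_mat d d" for n
    using A pow_carrier_mat[of A d n] by simp
  have aff: "affine_zvass V"
    using \<open>finite Q\<close> finE E_sub lb map_A
    unfolding affine_zvass_def V_def tr_def by auto
  have mono: "monogenic V"
    using A unfolding monogenic_def V_def tr_def by auto
  have lb_rel: "(u, v) \<in> (case l of None \<Rightarrow> Id | Some a \<Rightarrow> ?\<alpha> a) \<longleftrightarrow>
      v = map_mat int (A ^\<^sub>m fst (lb l)) *\<^sub>v u + snd (lb l)" if "u \<in> carrier_vec d" for l u v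
  proof (cases l)
    case None
    have "map_mat int (A ^\<^sub>m 0) = 1\<^sub>m d" using A by (auto intro!: eq_matI)
    with None that show ?thesis by (auto simp: lb_def)
  next
    case (Some a)
    with that show ?thesis by (auto simp: lb_def affine_rel_def split: prod.split)
  qed
  have step: "((f p, u), (f q, v)) \<in> step_rel V \<longleftrightarrow> ((p, u), (q, v)) \<in> edge_rel ?\<alpha> E"
    if pq: "p \<in> Q" "q \<in> Q" "u \<in> carrier_vec d" for p q u v
  proof
    assume "((f p, u), (f q, v)) \<in> step_rel V"
    then obtain p' l q' where e: "(p', l, q') \<in> E" "f p' = f p" "f q' = f q"
      "v = map_mat int (A ^\<^sub>m fst (lb l)) *\<^sub>v u + snd (lb l)"
      unfolding step_rel_def trans_rel_def V_def tr_def by auto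
    then have "p' = p" "q' = q" using E_sub f pq by (meson inj_onD)+
    then show "((p, u), (q, v)) \<in> edge_rel ?\<alpha> E"
      using e lb_rel[OF pq(3)] unfolding edge_rel_def by blast
  next
    assume "((p, u), (q, v)) \<in> edge_rel ?\<alpha> E"
    then obtain l where e: "(p, l, q) \<in> E"
      and v: "v = map_mat int (A ^\<^sub>m fst (lb l)) *\<^sub>v u + snd (lb l)"
      using lb_rel[OF pq(3)] unfolding edge_rel_def by auto
    have "v \<in> carrier_vec d" unfolding v
      using mult_mat_vec_carrier[OF map_A pq(3)] lb by (intro add_carrier_vec)
    then have "((f p, u), (f q, v)) \<in> trans_rel V (tr (p, l, q))"
      using pq v unfolding trans_rel_def tr_def V_def configs_def by auto
    with e show "((f p, u), (f q, v)) \<in> step_rel V"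
      unfolding step_rel_def V_def by force
  qed
  have "reaches V (f [r], u) (f [], v) \<longleftrightarrow> (([r], u), ([], v)) \<in> (edge_rel ?\<alpha> E)\<^sup>*"
    if "u \<in> carrier_vec d" for u v
    unfolding reaches_def
  proof (rule rtrancl_map_prod_inj[where Q = Q and D = "carrier_vec d"])
    show "edge_rel ?\<alpha> E \<subseteq> (Q \<times> UNIV) \<times> (Q \<times> UNIV)"
      using E_sub by (auto simp: edge_rel_def)
    show "step_rel V \<subseteq> (f ` Q \<times> carrier_vec d) \<times> (f ` Q \<times> carrier_vec d)"
      unfolding step_rel_def trans_rel_def configs_def V_def by auto
  qed (use f that step in \<open>auto simp: Q_def\<close>)
  then show thesis
    using that[OF aff mono] edges_correct[of r _ _ ?\<alpha>] by (auto simp: E_def V_def Q_def)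
qed

section \<open>Counter programs\<close>

datatype action = Inc nat | Dec nat | Zer nat

primrec act :: "action \<Rightarrow> ((nat \<Rightarrow> nat) \<times> (nat \<Rightarrow> nat)) set" where
  "act (Inc r) = {(s, t). t = s(r := Suc (s r))}"
| "act (Dec r) = {(s, t). s r > 0 \<and> t = s(r := s r - 1)}"
| "act (Zer r) = {(s, t). s r = 0 \<and> t = s}"

abbreviation exec :: "action rx \<Rightarrow> ((nat \<Rightarrow> nat) \<times> (nat \<Rightarrow> nat)) set" where
  "exec \<equiv> den act"

abbreviation Do :: "'a \<Rightarrow> 'a rx" where "Do a \<equiv> Sym [a]"

text \<open>The loop may be left at any time, but the zero test discards every run that leaves too
  early. The same device makes \<open>move\<close> a function.\<close>

definition clear :: "nat \<Rightarrow> action rx" where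
  "clear r = Seq (Star (Do (Dec r))) (Do (Zer r))"

definition havoc :: "nat \<Rightarrow> action rx" where
  "havoc r = Star (Sym [Inc r, Dec r])"

definition move :: "nat \<Rightarrow> nat list \<Rightarrow> action rx" where
  "move a bs = Seq (Star (foldr (\<lambda>b. Seq (Do (Inc b))) bs (Do (Dec a)))) (Do (Zer a))"

lemma exec_clear: "(s, t) \<in> exec (clear r) \<longleftrightarrow> t = s(r := 0)"
proof
  have *: "(s, t) \<in> (act (Dec r))\<^sup>* \<Longrightarrow> t r = 0 \<Longrightarrow> t = s(r := 0)" for s t
    by (induction rule: converse_rtrancl_induct) (auto simp: fun_eq_iff)
  show "t = s(r := 0)" if "(s, t) \<in> exec (clear r)"
    using that *[of s t] unfolding clear_def by auto
  have "(s(r := n), s(r := 0)) \<in> (act (Dec r))\<^sup>*" for n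
  proof (induction n)
    case (Suc n)
    have "(s(r := Suc n), s(r := n)) \<in> act (Dec r)" by simp
    with Suc show ?case by (rule converse_rtrancl_into_rtrancl[rotated])
  qed simp
  from this[of "s r"] have "(s, s(r := 0)) \<in> (act (Dec r))\<^sup>*" by simp
  then show "(s, t) \<in> exec (clear r)" if "t = s(r := 0)"
    unfolding that clear_def by auto
qed

lemma exec_havoc: "(s, t) \<in> exec (havoc r) \<longleftrightarrow> (\<exists>v. t = s(r := v))"
proof
  assume "(s, t) \<in> exec (havoc r)"
  then have "(s, t) \<in> (act (Inc r) \<union> act (Dec r))\<^sup>*" by (simp add: havoc_def)
  then show "\<exists>v. t = s(r := v)"
  proof (induction rule: rtrancl_induct)
    case base
    show ?case by (intro exI[of _ "s r"]) simp
  next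
    case (step t u)
    then obtain v where "t = s(r := v)" by blast
    with step(2) have "u = s(r := Suc v) \<or> u = s(r := v - 1)" by auto
    then show ?case by blast
  qed
next
  assume "\<exists>v. t = s(r := v)"
  then obtain v where t: "t = s(r := v)" by blast
  have "(s, s(r := 0)) \<in> (act (Dec r))\<^sup>*"
    using exec_clear[of s _ r] by (auto simp: clear_def)
  moreover have "(s(r := 0), s(r := v)) \<in> (act (Inc r))\<^sup>*"
  proof (induction v)
    case (Suc v)
    have "(s(r := v), s(r := Suc v)) \<in> act (Inc r)" by simp
    with Suc show ?case by (rule rtrancl_into_rtrancl)
  qed simp
  ultimately have "(s, t) \<in> (act (Inc r) \<union> act (Dec r))\<^sup>*"
    unfolding t by (meson Un_upper1 Un_upper2 rtrancl_mono rtrancl_trans subsetD)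
  then show "(s, t) \<in> exec (havoc r)" by (simp add: havoc_def)
qed

lemma exec_move:
  assumes "a \<notin> set bs" "distinct bs"
  shows "(s, t) \<in> exec (move a bs) \<longleftrightarrow> t = (\<lambda>i. if i = a then 0 else if i \<in> set bs then s i + s a else s i)"
proof -
  let ?body = "foldr (\<lambda>b. Seq (Do (Inc b))) bs (Do (Dec a))"
  have body: "(s, t) \<in> exec ?body \<longleftrightarrow>
      s a > 0 \<and> t = (\<lambda>i. if i = a then s a - 1 else if i \<in> set bs then Suc (s i) else s i)" for s t
    using assms
  proof (induction bs arbitrary: s)
    case Nil
    then show ?case by (auto simp: fun_eq_iff)
  next
    case (Cons b bs)
    have "(s, t) \<in> exec (foldr (\<lambda>b. Seq (Do (Inc b))) (b # bs) (Do (Dec a))) \<longleftrightarrow>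
       (s(b := Suc (s b)), t) \<in> exec (foldr (\<lambda>b. Seq (Do (Inc b))) bs (Do (Dec a)))" by auto
    also have "\<dots> \<longleftrightarrow> s a > 0 \<and> t = (\<lambda>i. if i = a then (s(b := Suc (s b))) a - 1
       else if i \<in> set bs then Suc ((s(b := Suc (s b))) i) else (s(b := Suc (s b))) i)"
      using Cons.prems by (subst Cons.IH) auto
    also have "(\<lambda>i. if i = a then (s(b := Suc (s b))) a - 1
       else if i \<in> set bs then Suc ((s(b := Suc (s b))) i) else (s(b := Suc (s b))) i) =
       (\<lambda>i. if i = a then s a - 1 else if i \<in> set (b # bs) then Suc (s i) else s i)"
      using Cons.prems by (auto simp: fun_eq_iff)
    finally show ?case .
  qed
  \<comment> \<open>\<open>fin\<close> predicts the final store and is constant along the rounds: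
    each takes one unit from \<open>a\<close> and gives one to every register of
    \<open>bs\<close>.\<close>
  define fin where "fin s = (\<lambda>i. if i = a then 0 else if i \<in> set bs then s i + s a else s i)" for s :: "nat \<Rightarrow> nat"
  have sound: "(s, t) \<in> (exec ?body)\<^sup>* \<Longrightarrow> t a = 0 \<Longrightarrow> t = fin s" for s t
  proof (induction rule: converse_rtrancl_induct)
    case base
    then show ?case by (auto simp: fin_def fun_eq_iff)
  next
    case (step y z)
    then have "t = fin z" by simp
    also have "fin z = fin y" using step(1) assms by (auto simp: body fin_def fun_eq_iff)
    finally show ?case .
  qed
  have complete: "(s, fin s) \<in> (exec ?body)\<^sup>*"
  proof -
    define u where "u n = (\<lambda>i. if i = a then s a - n else if i \<in> set bs then s i + n else s i)" for n
    have "n \<le> s a \<Longrightarrow> (s, u n) \<in> (exec ?body)\<^sup>*" for n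
    proof (induction n)
      case 0
      have "u 0 = s" by (auto simp: u_def)
      then show ?case by simp
    next
      case (Suc n)
      then have "(u n, u (Suc n)) \<in> exec ?body" by (auto simp: body u_def fun_eq_iff)
      with Suc show ?case by (meson Suc_leD rtrancl_into_rtrancl)
    qed
    moreover have "u (s a) = fin s" by (auto simp: u_def fin_def)
    ultimately show ?thesis by (metis order_refl)
  qed
  have "fin s a = 0" by (simp add: fin_def)
  then have "(s, t) \<in> exec (move a bs) \<longleftrightarrow> t = fin s"
    unfolding move_def using sound[of s t] complete by auto
  then show ?thesis by (simp add: fin_def)
qed

text \<open>The registers from \<open>b\<close> on are the scratch space of the test.\<close>

definition testable :: "nat \<Rightarrow> ((nat \<Rightarrow> nat) \<Rightarrow> bool) \<Rightarrow> bool" where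
  "testable b \<Phi> \<longleftrightarrow> (\<exists>c. \<forall>s t. (\<forall>i\<ge>b. s i = 0) \<longrightarrow> ((s, t) \<in> exec c \<longleftrightarrow> t = s \<and> \<Phi> s))"

lemma testable_cong: "testable b \<Phi> \<Longrightarrow> (\<And>s. \<forall>i\<ge>b. s i = 0 \<Longrightarrow> \<Phi> s = \<Psi> s) \<Longrightarrow> testable b \<Psi>"
  unfolding testable_def by (metis (no_types, lifting))

lemma testable_conj: "testable b \<Phi> \<Longrightarrow> testable b \<Psi> \<Longrightarrow> testable b (\<lambda>s. \<Phi> s \<and> \<Psi> s)"
proof -
  assume "testable b \<Phi>" "testable b \<Psi>"
  then obtain c d where
    "\<forall>s t. (\<forall>i\<ge>b. s i = 0) \<longrightarrow> ((s, t) \<in> exec c \<longleftrightarrow> t = s \<and> \<Phi> s)"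
    "\<forall>s t. (\<forall>i\<ge>b. s i = 0) \<longrightarrow> ((s, t) \<in> exec d \<longleftrightarrow> t = s \<and> \<Psi> s)"
    unfolding testable_def by blast
  then show ?thesis
    unfolding testable_def by (intro exI[of _ "Seq c d"]) (auto simp: relcomp_unfold)
qed

lemma testable_disj: "testable b \<Phi> \<Longrightarrow> testable b \<Psi> \<Longrightarrow> testable b (\<lambda>s. \<Phi> s \<or> \<Psi> s)"
proof -
  assume "testable b \<Phi>" "testable b \<Psi>"
  then obtain c d where
    "\<forall>s t. (\<forall>i\<ge>b. s i = 0) \<longrightarrow> ((s, t) \<in> exec c \<longleftrightarrow> t = s \<and> \<Phi> s)"
    "\<forall>s t. (\<forall>i\<ge>b. s i = 0) \<longrightarrow> ((s, t) \<in> exec d \<longleftrightarrow> t = s \<and> \<Psi> s)"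
    unfolding testable_def by blast
  then show ?thesis
    unfolding testable_def by (intro exI[of _ "Alt c d"]) auto
qed

lemma testable_False: "testable b (\<lambda>s. False)"
  unfolding testable_def by (intro exI[of _ "Sym []"]) auto

lemma testable_zero: "testable b (\<lambda>s. s r = 0)"
  unfolding testable_def by (intro exI[of _ "Do (Zer r)"]) auto

text \<open>A quantifier is a guess: \<open>havoc\<close> chooses a value for register
  \<open>b\<close>, the inner test works with scratch space from \<open>Suc b\<close> on, and
  \<open>clear\<close> restores the zero that was there.\<close>

lemma testable_ex:
  assumes "testable (Suc b) \<Phi>"
  shows "testable b (\<lambda>s. \<exists>v. \<Phi> (s(b := v)))"
proof -
  from assms obtain c where
    c: "\<And>s t. (\<forall>i\<ge>Suc b. s i = 0) \<Longrightarrow> ((s, t) \<in> exec c \<longleftrightarrow> t = s \<and> \<Phi> s)"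
    unfolding testable_def by blast
  have "(s, t) \<in> exec (Seq (havoc b) (Seq c (clear b))) \<longleftrightarrow> t = s \<and> (\<exists>v. \<Phi> (s(b := v)))"
    if s: "\<forall>i\<ge>b. s i = 0" for s t
  proof -
    have "(s(b := v), x) \<in> exec c \<longleftrightarrow> x = s(b := v) \<and> \<Phi> (s(b := v))" for v x
      using s by (intro c) auto
    moreover have "s(b := 0) = s" using s by auto
    ultimately show ?thesis by (auto simp: relcomp_unfold exec_havoc exec_clear)
  qed
  then show ?thesis unfolding testable_def by blast
qed

lemma testable_True: "testable b (\<lambda>s. True)"
  \<comment> \<open>The reflexive closure of the empty relation is the program that does
    nothing.\<close>
  unfolding testable_def by (intro exI[of _ "Star (Sym [])"]) auto

text \<open>Counting both registers down destroys them, so the number of rounds is recorded in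
  \<open>b\<close>, from which \<open>move\<close> restores both. The case \<open>x = y\<close> is
  separate because a round would decrement the same register twice.\<close>

lemma testable_eq:
  assumes "x < b" "y < b"
  shows "testable b (\<lambda>s. s x = s y)"
proof (cases "x = y")
  case True
  then show ?thesis using testable_True by simp
next
  case False
  let ?body = "Seq (Do (Dec x)) (Seq (Do (Dec y)) (Do (Inc b)))"
  let ?c = "Seq (Star ?body) (Seq (Do (Zer x)) (Seq (Do (Zer y)) (move b [x, y])))"
  have body: "(s, t) \<in> exec ?body \<longleftrightarrow>
      0 < s x \<and> 0 < s y \<and> t = s(x := s x - 1, y := s y - 1, b := Suc (s b))" for s t
    using assms False by (auto simp: relcomp_unfold)
  have inv: "(s, t) \<in> (exec ?body)\<^sup>* \<Longrightarrow> t x + t b = s x + s b \<and> t y + t b = s y + s b \<and>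
      (\<forall>i. i \<notin> {x, y, b} \<longrightarrow> t i = s i)" for s t
  proof (induction rule: rtrancl_induct)
    case (step u t)
    then show ?case using assms False by (auto simp: body)
  qed simp
  have reach: "n \<le> s x \<Longrightarrow> n \<le> s y \<Longrightarrow>
      (s, s(x := s x - n, y := s y - n, b := s b + n)) \<in> (exec ?body)\<^sup>*" for n s
  proof (induction n)
    case (Suc n)
    then have "(s(x := s x - n, y := s y - n, b := s b + n),
        s(x := s x - Suc n, y := s y - Suc n, b := s b + Suc n)) \<in> exec ?body"
      unfolding body using assms False by (auto simp: fun_eq_iff)
    with Suc show ?case by (meson Suc_leD rtrancl_into_rtrancl)
  qed simp
  have b: "b \<notin> set [x, y]" "distinct [x, y]" using assms False by auto
  have "(s, t) \<in> exec ?c \<longleftrightarrow> t = s \<and> s x = s y" if s: "s b = 0" for s t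
  proof
    assume "(s, t) \<in> exec ?c"
    then obtain u where u: "(s, u) \<in> (exec ?body)\<^sup>*" "u x = 0" "u y = 0" "(u, t) \<in> exec (move b [x, y])"
      by (auto simp: relcomp_unfold)
    from u(4)[unfolded exec_move[OF b]] inv[OF u(1)] s u(2,3) assms False
    show "t = s \<and> s x = s y" by (auto simp: fun_eq_iff)
  next
    assume *: "t = s \<and> s x = s y"
    define u where "u = s(x := 0, y := 0, b := s x)"
    have "(s, u) \<in> (exec ?body)\<^sup>*" using reach[of "s x" s] * s by (simp add: u_def)
    moreover have "(u, t) \<in> exec (move b [x, y])"
      unfolding exec_move[OF b] using * s assms False by (auto simp: u_def fun_eq_iff)
    moreover have "u x = 0" "u y = 0" using assms False by (auto simp: u_def)
    ultimately show "(s, t) \<in> exec ?c" by auto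
  qed
  then show ?thesis unfolding testable_def by (intro exI[of _ ?c]) simp
qed

lemma testable_Suc:
  assumes "x < b" "y < b"
  shows "testable b (\<lambda>s. s x = Suc (s y))"
proof (cases "x = y")
  case True
  then show ?thesis using testable_False by simp
next
  case False
  from testable_eq[OF assms] obtain c where
    c: "\<And>s t. (\<forall>i\<ge>b. s i = 0) \<Longrightarrow> ((s, t) \<in> exec c \<longleftrightarrow> t = s \<and> s x = s y)"
    unfolding testable_def by blast
  have "(s, t) \<in> exec (Seq (Do (Dec x)) (Seq c (Do (Inc x)))) \<longleftrightarrow> t = s \<and> s x = Suc (s y)"
    if s: "\<forall>i\<ge>b. s i = 0" for s t
  proof -
    have "(s(x := v), u) \<in> exec c \<longleftrightarrow> u = s(x := v) \<and> v = s y" for v u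
      using s assms False c[of "s(x := v)" u] by auto
    then show ?thesis by (auto simp: relcomp_unfold simp del: fun_upd_apply)
        (simp_all add: fun_upd_idem)
  qed
  then show ?thesis unfolding testable_def by blast
qed

section \<open>Enumerating pairs with a counter program\<close>

text \<open>With the next two facts, this is the order of Cantor's enumeration: on a diagonal the
  first component grows, and after \<open>(x, 0)\<close> comes \<open>(0, Suc x)\<close>.\<close>

lemma prod_encode_Suc_fst: "prod_encode (Suc x, y) = Suc (prod_encode (x, Suc y))"
  by (simp add: prod_encode_def)

lemma prod_encode_0_Suc: "prod_encode (0, Suc x) = Suc (prod_encode (x, 0))"
  by (simp add: prod_encode_def)

lemma prod_encode_0_0: "prod_encode (0, 0) = 0"
  by (simp add: prod_encode_def)

lemma den_Seq_iff: "(s, t) \<in> den \<alpha> (Seq c d) \<longleftrightarrow> (\<exists>u. (s, u) \<in> den \<alpha> c \<and> (u, t) \<in> den \<alpha> d)"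
  by auto

lemma den_Alt_iff: "(s, t) \<in> den \<alpha> (Alt c d) \<longleftrightarrow> (s, t) \<in> den \<alpha> c \<or> (s, t) \<in> den \<alpha> d"
  by auto

text \<open>The pairs are enumerated along the diagonals, counting the steps.\<close>

definition next_pair :: "nat \<Rightarrow> nat \<Rightarrow> nat \<Rightarrow> action rx" where
  "next_pair x y z = Seq (Do (Inc z)) (Alt (Seq (Do (Dec y)) (Do (Inc x)))
     (Seq (Do (Zer y)) (Seq (move x [y]) (Do (Inc y)))))"

lemma exec_next_pair:
  assumes "distinct [x, y, z]"
  shows "(s, t) \<in> exec (next_pair x y z) \<longleftrightarrow> t = (if 0 < s y
      then s(x := Suc (s x), y := s y - 1, z := Suc (s z))
      else s(x := 0, y := Suc (s x), z := Suc (s z)))"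
proof -
  have mv: "x \<notin> set [y]" "distinct [y]" using assms by auto
  have 1: "s(z := Suc (s z), y := s y - 1, x := Suc (s x)) =
     s(x := Suc (s x), y := s y - 1, z := Suc (s z))"
    using assms by (auto simp: fun_eq_iff)
  have 2: "(\<lambda>i. if i = x then 0 else if i \<in> set [y] then (s(z := Suc (s z))) i + (s(z := Suc (s z))) x
      else (s(z := Suc (s z))) i)(y := Suc (s x)) = s(x := 0, y := Suc (s x), z := Suc (s z))"
    using assms by (auto simp: fun_eq_iff)
  have A: "(s(z := Suc (s z)), t) \<in> exec (Seq (Do (Dec y)) (Do (Inc x))) \<longleftrightarrow>
     0 < s y \<and> t = s(z := Suc (s z), y := s y - 1, x := Suc (s x))"
    using assms by (simp add: relcomp_unfold)
  have B: "(s(z := Suc (s z)), t) \<in> exec (Seq (Do (Zer y)) (Seq (move x [y]) (Do (Inc y)))) \<longleftrightarrow>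
     s y = 0 \<and> t = (\<lambda>i. if i = x then 0 else if i \<in> set [y] then (s(z := Suc (s z))) i + (s(z := Suc (s z))) x
      else (s(z := Suc (s z))) i)(y := Suc (s x))"
    unfolding den_Seq_iff exec_move[OF mv] using assms by auto
  have "(s, t) \<in> exec (next_pair x y z) \<longleftrightarrow>
      (s(z := Suc (s z)), t) \<in> exec (Seq (Do (Dec y)) (Do (Inc x))) \<or>
      (s(z := Suc (s z)), t) \<in> exec (Seq (Do (Zer y)) (Seq (move x [y]) (Do (Inc y))))"
    unfolding next_pair_def den_Seq_iff[of _ _ _ "Do (Inc z)"] den_Alt_iff by auto
  then show ?thesis unfolding A B 1 2 by auto
qed

text \<open>The enumeration visits every pair, and the number of steps made is its code. As the loop
  may stop anywhere, it guesses a pair and computes its code at the same time, without any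
  arithmetic beyond counting.\<close>

lemma exec_Star_next_pair:
  assumes xyz: "distinct [x, y, z]" and s: "s x = 0" "s y = 0" "s z = 0"
  shows "(s, t) \<in> exec (Star (next_pair x y z)) \<longleftrightarrow>
    (\<exists>m n. t = s(x := m, y := n, z := prod_encode (m, n)))"
proof -
  let ?up = "\<lambda>m n. s(x := m, y := n, z := prod_encode (m, n))"
  have "?up 0 0 = s" using s by (auto simp: fun_eq_iff prod_encode_0_0)
  have dec: "(?up m (Suc n), ?up (Suc m) n) \<in> exec (next_pair x y z)" for m n
    unfolding exec_next_pair[OF xyz] using xyz by (auto simp: fun_eq_iff prod_encode_Suc_fst)
  have zer: "(?up m 0, ?up 0 (Suc m)) \<in> exec (next_pair x y z)" for m
    unfolding exec_next_pair[OF xyz] using xyz by (auto simp: fun_eq_iff prod_encode_0_Suc)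
  \<comment> \<open>Determinism turns the two explicit steps into the only possible ones, which is
    what soundness needs.\<close>
  have det: "u = v" if "(t, u) \<in> exec (next_pair x y z)" "(t, v) \<in> exec (next_pair x y z)" for t u v
    using that unfolding exec_next_pair[OF xyz] by simp
  have complete: "(s, ?up m n) \<in> (exec (next_pair x y z))\<^sup>*" for m n
  proof (induction "prod_encode (m, n)" arbitrary: m n)
    case 0
    then have "prod_encode (m, n) = prod_encode (0, 0)" by (simp add: prod_encode_0_0)
    then have "m = 0" "n = 0" by (simp_all add: prod_encode_eq)
    with \<open>?up 0 0 = s\<close> have "?up m n = s" by (simp only:)
    then have "(s, ?up m n) \<in> (exec (next_pair x y z))\<^sup>*" by (simp only: rtrancl.rtrancl_refl)
    then show ?case .
  next
    case (Suc k)
    show ?case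
    proof (cases m)
      case (Suc m')
      with \<open>Suc k = _\<close> have "k = prod_encode (m', Suc n)" by (simp add: prod_encode_Suc_fst)
      from Suc.hyps(1)[OF this] dec[of m' n] show ?thesis
        unfolding Suc by (rule rtrancl_into_rtrancl)
    next
      case 0
      with Suc.hyps(2) obtain n' where n: "n = Suc n'" by (cases n) (auto simp: prod_encode_def)
      with 0 Suc.hyps(2) have "k = prod_encode (n', 0)" by (simp add: prod_encode_0_Suc)
      from Suc.hyps(1)[OF this] zer[of n'] show ?thesis
        unfolding 0 n by (rule rtrancl_into_rtrancl)
    qed
  qed
  have sound: "\<exists>m n. t = ?up m n" if "(s, t) \<in> (exec (next_pair x y z))\<^sup>*" for t
    using that
  proof (induction rule: rtrancl_induct)
    case base
    show ?case using \<open>?up 0 0 = s\<close> by metis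
  next
    case (step t u)
    then obtain m n where t: "t = ?up m n" by blast
    show ?case
    proof (cases n)
      case 0
      with step(2) t have "u = ?up 0 (Suc m)" by (intro det[OF _ zer]) simp
      then show ?thesis by blast
    next
      case (Suc n')
      with step(2) t have "u = ?up (Suc m) n'" by (intro det[OF _ dec]) simp
      then show ?thesis by blast
    qed
  qed
  from sound complete show ?thesis unfolding den.simps by blast
qed

lemma testable_ex_prod_encode:
  assumes "testable (b + 3) \<Phi>"
  shows "testable b (\<lambda>s. \<exists>m n. \<Phi> (s(b := m, b + 1 := n, b + 2 := prod_encode (m, n))))"
proof -
  define y z where "y = b + 1" and "z = b + 2"
  have xyz: "distinct [b, y, z]" by (auto simp: y_def z_def)
  let ?up = "\<lambda>s m n. s(b := m, y := n, z := prod_encode (m, n))"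
  from assms obtain c where
    c: "\<And>s t. (\<forall>i\<ge>b + 3. s i = 0) \<Longrightarrow> ((s, t) \<in> exec c \<longleftrightarrow> t = s \<and> \<Phi> s)"
    unfolding testable_def by blast
  let ?d = "Seq (Star (next_pair b y z)) (Seq c (Seq (clear b) (Seq (clear y) (clear z))))"
  have "(s, t) \<in> exec ?d \<longleftrightarrow> t = s \<and> (\<exists>m n. \<Phi> (?up s m n))" if s: "\<forall>i\<ge>b. s i = 0" for s t
  proof -
    have s0: "s b = 0" "s y = 0" "s z = 0" using s by (auto simp: y_def z_def)
    have exec_c: "(?up s m n, u) \<in> exec c \<longleftrightarrow> u = ?up s m n \<and> \<Phi> (?up s m n)" for m n u
      using s by (intro c) (auto simp: y_def z_def)
    have reset: "(?up s m n)(b := 0, y := 0, z := 0) = s" for m n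
      using s0 xyz by (auto simp: fun_eq_iff)
    have "(s, t) \<in> exec ?d \<longleftrightarrow> (\<exists>m n u. (?up s m n, u) \<in> exec c \<and> t = u(b := 0, y := 0, z := 0))"
      unfolding den_Seq_iff exec_Star_next_pair[OF xyz s0] exec_clear by blast
    also have "\<dots> \<longleftrightarrow> t = s \<and> (\<exists>m n. \<Phi> (?up s m n))"
      unfolding exec_c using reset by metis
    finally show ?thesis .
  qed
  then show ?thesis unfolding testable_def y_def z_def by blast
qed

lemma testable_prod_encode:
  assumes "x < b" "y < b" "z < b"
  shows "testable b (\<lambda>s. s z = prod_encode (s x, s y))"
proof -
  have "testable (b + 3) (\<lambda>s. s b = s x \<and> s (b + 1) = s y \<and> s (b + 2) = s z)"
    using assms by (intro testable_conj testable_eq) auto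
  from testable_ex_prod_encode[OF this] show ?thesis
    by (rule testable_cong) (use assms in auto)
qed


section \<open>Rewriting of terms over the pairing function\<close>

datatype trm = TVar nat | TZero | TSuc trm | TPair trm trm

primrec val :: "(nat \<Rightarrow> nat) \<Rightarrow> trm \<Rightarrow> nat" where
  "val s (TVar i) = s i"
| "val s TZero = 0"
| "val s (TSuc t) = Suc (val s t)"
| "val s (TPair t u) = prod_encode (val s t, val s u)"

primrec vars :: "trm \<Rightarrow> nat set" where
  "vars (TVar i) = {i}"
| "vars TZero = {}"
| "vars (TSuc t) = vars t"
| "vars (TPair t u) = vars t \<union> vars u"

lemma val_cong: "(\<And>i. i \<in> vars t \<Longrightarrow> s i = s' i) \<Longrightarrow> val s t = val s' t"
  by (induction t) auto

text \<open>Values of subterms are not computed but guessed in fresh registers and then checked. The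
  scratch space moves up with each nesting level, hence the induction for arbitrary
  \<open>b\<close>.\<close>

lemma testable_val: "vars t \<subseteq> {..<b} \<Longrightarrow> r < b \<Longrightarrow> testable b (\<lambda>s. s r = val s t)"
proof (induction t arbitrary: b r)
  case (TVar i)
  then show ?case by (simp add: testable_eq)
next
  case TZero
  then show ?case by (simp add: testable_zero)
next
  case (TSuc t)
  have "testable (Suc b) (\<lambda>s. s b = val s t \<and> s r = Suc (s b))"
    using TSuc.prems by (intro testable_conj TSuc.IH testable_Suc) auto
  from testable_ex[OF this] show ?case
  proof (rule testable_cong)
    fix s :: "nat \<Rightarrow> nat"
    have "val (s(b := v)) t = val s t" for v using TSuc.prems by (intro val_cong) auto
    with TSuc.prems show "(\<exists>v. (s(b := v)) b = val (s(b := v)) t \<and> (s(b := v)) r = Suc ((s(b := v)) b))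
        \<longleftrightarrow> s r = val s (TSuc t)" by auto
  qed
next
  case (TPair t u)
  have "testable (b + 2) (\<lambda>s. s b = val s t \<and> s (Suc b) = val s u \<and> s r = prod_encode (s b, s (Suc b)))"
    using TPair.prems by (intro testable_conj TPair.IH testable_prod_encode) auto
  then have "testable (Suc (Suc b)) (\<lambda>s. s b = val s t \<and> s (Suc b) = val s u \<and> s r = prod_encode (s b, s (Suc b)))"
    by simp
  from testable_ex[OF testable_ex[OF this]] show ?case
  proof (rule testable_cong)
    fix s :: "nat \<Rightarrow> nat"
    have "val (s(b := v, Suc b := w)) t = val s t" "val (s(b := v, Suc b := w)) u = val s u" for v w
      using TPair.prems by (auto intro!: val_cong)
    with TPair.prems show "(\<exists>v w. (s(b := v, Suc b := w)) b = val (s(b := v, Suc b := w)) t \<and>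
        (s(b := v, Suc b := w)) (Suc b) = val (s(b := v, Suc b := w)) u \<and>
        (s(b := v, Suc b := w)) r = prod_encode ((s(b := v, Suc b := w)) b, (s(b := v, Suc b := w)) (Suc b)))
        \<longleftrightarrow> s r = val s (TPair t u)" by auto
  qed
qed

text \<open>A rule rewrites the whole number, never a part below the root. A variable that occurs
  only on the right may take any value; this is how a run guesses intermediate results, such as the
  value of an inner function.\<close>

definition rewrite_rel :: "(trm \<times> trm) list \<Rightarrow> (nat \<times> nat) set" where
  "rewrite_rel rs = {(val s l, val s r) | s l r. (l, r) \<in> set rs}"

lemma testable_ex_many:
  "testable (b + k) \<Phi> \<Longrightarrow> testable b (\<lambda>s. \<exists>s'. (\<forall>i. i < b \<or> i \<ge> b + k \<longrightarrow> s' i = s i) \<and> \<Phi> s')"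
proof (induction k arbitrary: \<Phi>)
  case 0
  have "(\<forall>i. i < b \<or> i \<ge> b + 0 \<longrightarrow> s' i = s i) \<longleftrightarrow> s' = s" for s s' :: "nat \<Rightarrow> nat"
    by (auto simp: fun_eq_iff)
  with 0 show ?case by simp
next
  case (Suc k)
  from Suc.prems have "testable (Suc (b + k)) \<Phi>" by simp
  from Suc.IH[OF testable_ex[OF this]] show ?case
  proof (rule testable_cong)
    fix s :: "nat \<Rightarrow> nat"
    show "(\<exists>s'. (\<forall>i. i < b \<or> b + k \<le> i \<longrightarrow> s' i = s i) \<and> (\<exists>v. \<Phi> (s'(b + k := v)))) \<longleftrightarrow>
        (\<exists>s'. (\<forall>i. i < b \<or> b + Suc k \<le> i \<longrightarrow> s' i = s i) \<and> \<Phi> s')"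
    proof safe
      fix s' v
      assume "\<forall>i. i < b \<or> b + k \<le> i \<longrightarrow> s' i = s i" "\<Phi> (s'(b + k := v))"
      then show "\<exists>s'. (\<forall>i. i < b \<or> b + Suc k \<le> i \<longrightarrow> s' i = s i) \<and> \<Phi> s'"
        by (intro exI[of _ "s'(b + k := v)"]) auto
    next
      fix s'
      assume "\<forall>i. i < b \<or> b + Suc k \<le> i \<longrightarrow> s' i = s i" "\<Phi> s'"
      then show "\<exists>s'. (\<forall>i. i < b \<or> b + k \<le> i \<longrightarrow> s' i = s i) \<and> (\<exists>v. \<Phi> (s'(b + k := v)))"
        by (intro exI[of _ "s'(b + k := s (b + k))"] conjI exI[of _ "s' (b + k)"]) auto
    qed
  qed
qed

text \<open>Registers \<open>0\<close> and \<open>1\<close> hold the two sides of a rewrite step, so the variables of a rule are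
  the registers from \<open>2\<close> on.\<close>

lemma testable_rewrite_rel:
  assumes "\<And>l r. (l, r) \<in> set rs \<Longrightarrow> vars l \<union> vars r \<subseteq> {2..<b}" "2 \<le> b"
  shows "testable 2 (\<lambda>s. (s 0, s 1) \<in> rewrite_rel rs)"
proof -
  have rule: "testable b (\<lambda>s. \<exists>(l, r)\<in>set rs. s 0 = val s l \<and> s 1 = val s r)"
    using assms(1)
  proof (induction rs)
    case (Cons lr rs)
    obtain l r where lr: "lr = (l, r)" by fastforce
    have "testable b (\<lambda>s. (s 0 = val s l \<and> s 1 = val s r) \<or>
        (\<exists>(l, r)\<in>set rs. s 0 = val s l \<and> s 1 = val s r))"
    proof (intro testable_disj testable_conj testable_val Cons.IH)
      show "vars l \<subseteq> {..<b}" "vars r \<subseteq> {..<b}" using Cons.prems[of l r] by (auto simp: lr)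
    qed (use Cons.prems \<open>2 \<le> b\<close> in auto)
    then show ?case by (rule testable_cong) (auto simp: lr)
  qed (simp add: testable_False)
  have b: "2 + (b - 2) = b" using assms(2) by simp
  from rule have "testable (2 + (b - 2)) (\<lambda>s. \<exists>(l, r)\<in>set rs. s 0 = val s l \<and> s 1 = val s r)"
    by (simp only: b)
  from testable_ex_many[OF this, unfolded b] show ?thesis
  proof (rule testable_cong)
    fix s :: "nat \<Rightarrow> nat"
    assume s: "\<forall>i\<ge>2. s i = 0"
    show "(\<exists>s'. (\<forall>i. i < 2 \<or> b \<le> i \<longrightarrow> s' i = s i) \<and>
        (\<exists>(l, r)\<in>set rs. s' 0 = val s' l \<and> s' 1 = val s' r)) \<longleftrightarrow> (s 0, s 1) \<in> rewrite_rel rs"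
    proof
      assume "(s 0, s 1) \<in> rewrite_rel rs"
      then obtain u l r where lr: "(l, r) \<in> set rs" "s 0 = val u l" "s 1 = val u r"
        unfolding rewrite_rel_def by auto
      let ?s = "\<lambda>i. if 2 \<le> i \<and> i < b then u i else s i"
      have "val ?s l = val u l" "val ?s r = val u r"
        using assms(1)[OF lr(1)] by (auto intro!: val_cong)
      with lr show "\<exists>s'. (\<forall>i. i < 2 \<or> b \<le> i \<longrightarrow> s' i = s i) \<and>
          (\<exists>(l, r)\<in>set rs. s' 0 = val s' l \<and> s' 1 = val s' r)"
        by (intro exI[of _ ?s] conjI bexI[of _ "(l, r)"]) simp_all
    next
      assume "\<exists>s'. (\<forall>i. i < 2 \<or> b \<le> i \<longrightarrow> s' i = s i) \<and>
        (\<exists>(l, r)\<in>set rs. s' 0 = val s' l \<and> s' 1 = val s' r)"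
      then obtain s' l r where "\<forall>i. i < 2 \<or> b \<le> i \<longrightarrow> s' i = s i" "(l, r) \<in> set rs"
        "s' 0 = val s' l" "s' 1 = val s' r"
        by blast
      then have "s 0 = val s' l" "s 1 = val s' r" "(l, r) \<in> set rs" by auto
      then show "(s 0, s 1) \<in> rewrite_rel rs"
        unfolding rewrite_rel_def by blast
    qed
  qed
qed

text \<open>Between two rounds all registers except 0 vanish, as the test assumes of its scratch
  space. A round guesses the successor in register 1, tests the pair, and lets the guess replace the
  content of register 0.\<close>

lemma rewrite_program:
  fixes rs :: "(trm \<times> trm) list"
  assumes vars2: "\<And>l r. (l, r) \<in> set rs \<Longrightarrow> vars l \<union> vars r \<subseteq> {2..}"
  obtains c where "\<And>n. (\<exists>t. ((\<lambda>_. 0)(0 := n), t) \<in> exec c) \<longleftrightarrow> (n, 0) \<in> (rewrite_rel rs)\<^sup>*"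
proof -
  have fin: "finite (vars t)" for t by (induction t) auto
  have "finite (\<Union>(l, r)\<in>set rs. vars l \<union> vars r)" using fin by auto
  then obtain b0 where b0: "\<forall>i\<in>(\<Union>(l, r)\<in>set rs. vars l \<union> vars r). i < b0"
    unfolding finite_nat_set_iff_bounded by blast
  have "vars l \<union> vars r \<subseteq> {2..<max 2 b0}" if "(l, r) \<in> set rs" for l r
  proof
    fix i assume i: "i \<in> vars l \<union> vars r"
    with b0 that have "i < b0" by blast
    moreover have "2 \<le> i" using i vars2[OF that] by auto
    ultimately show "i \<in> {2..<max 2 b0}" by simp
  qed
  then have "testable 2 (\<lambda>s. (s 0, s 1) \<in> rewrite_rel rs)"
    using testable_rewrite_rel[of rs "max 2 b0"] by simp
  then obtain c where
    c: "\<And>s t. (\<forall>i\<ge>2. s i = 0) \<Longrightarrow> ((s, t) \<in> exec c \<longleftrightarrow> t = s \<and> (s 0, s 1) \<in> rewrite_rel rs)"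
    unfolding testable_def by blast
  let ?st = "\<lambda>n. (\<lambda>_. 0)(0 := n) :: nat \<Rightarrow> nat"
  let ?body = "Seq (havoc 1) (Seq c (Seq (clear 0) (move 1 [0])))"
  have body: "(?st n, t) \<in> exec ?body \<longleftrightarrow> (\<exists>m. t = ?st m \<and> (n, m) \<in> rewrite_rel rs)" for n t
  proof -
    have exec_c: "((?st n)(1 := m), u) \<in> exec c \<longleftrightarrow> u = (?st n)(1 := m) \<and> (n, m) \<in> rewrite_rel rs" for m u
      using c[of "(?st n)(1 := m)" u] by simp
    have mv: "(1::nat) \<notin> set [0]" "distinct [0::nat]" by simp_all
    have "((?st n)(1 := m, 0 := 0), t) \<in> exec (move 1 [0]) \<longleftrightarrow> t = ?st m" for m
    proof -
      have "(\<lambda>i. if i = 1 then 0 else if i \<in> set [0] then ((?st n)(1 := m, 0 := 0)) i + ((?st n)(1 := m, 0 := 0)) 1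
          else ((?st n)(1 := m, 0 := 0)) i) = ?st m" by (auto simp: fun_eq_iff)
      then show ?thesis unfolding exec_move[OF mv] by (simp only:)
    qed
    moreover have "(?st n, t) \<in> exec ?body \<longleftrightarrow>
      (\<exists>m. (n, m) \<in> rewrite_rel rs \<and> ((?st n)(1 := m, 0 := 0), t) \<in> exec (move 1 [0]))"
      unfolding den_Seq_iff[of _ _ _ "havoc 1"] den_Seq_iff[of _ _ _ c]
        den_Seq_iff[of _ _ _ "clear 0"] exec_havoc exec_clear
      using exec_c by metis
    ultimately show ?thesis by (simp only:) blast
  qed
  have star: "(?st n, t) \<in> (exec ?body)\<^sup>* \<longleftrightarrow> (\<exists>m. t = ?st m \<and> (n, m) \<in> (rewrite_rel rs)\<^sup>*)" for n t
  proof
    assume "(?st n, t) \<in> (exec ?body)\<^sup>*"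
    then show "\<exists>m. t = ?st m \<and> (n, m) \<in> (rewrite_rel rs)\<^sup>*"
    proof (induction rule: rtrancl_induct)
      case (step t u)
      then obtain m where "t = ?st m" "(n, m) \<in> (rewrite_rel rs)\<^sup>*" by blast
      with step(2) body show ?case by (metis rtrancl_into_rtrancl)
    qed blast
  next
    have "(?st n, ?st m) \<in> (exec ?body)\<^sup>*" if "(n, m) \<in> (rewrite_rel rs)\<^sup>*" for m
      using that
    proof (induction rule: rtrancl_induct)
      case (step m k)
      then show ?case using body by (metis rtrancl_into_rtrancl)
    qed simp
    then show "(?st n, t) \<in> (exec ?body)\<^sup>*" if "\<exists>m. t = ?st m \<and> (n, m) \<in> (rewrite_rel rs)\<^sup>*"
      using that by blast
  qed
  have "(\<exists>t. (?st n, t) \<in> exec (Seq (Star ?body) (Do (Zer 0)))) \<longleftrightarrow> (n, 0) \<in> (rewrite_rel rs)\<^sup>*" for n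
    unfolding den_Seq_iff den.simps(4) star by auto
  then show thesis by (rule that)
qed

section \<open>Evaluation of recursive functions by rewriting\<close>

text \<open>Codes are built from the pairing function and from lists, which are themselves built
  from pairing and successor. The terms \<open>trm\<close> have exactly these operations, so rules
  can take codes apart.\<close>

primrec rec_code :: "recf \<Rightarrow> nat" where
  "rec_code Zero = prod_encode (0, 0)"
| "rec_code Succ = prod_encode (1, 0)"
| "rec_code (Proj i) = prod_encode (2, i)"
| "rec_code (Comp f gs) = prod_encode (3, prod_encode (rec_code f, list_encode (map rec_code gs)))"
| "rec_code (PrimRec f g) = prod_encode (4, prod_encode (rec_code f, rec_code g))"
| "rec_code (Mu f) = prod_encode (5, rec_code f)"

lemma rec_code_eq_iff:
  "prod_encode (0, c) = rec_code f \<longleftrightarrow> f = Zero \<and> c = 0"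
  "prod_encode (1, c) = rec_code f \<longleftrightarrow> f = Succ \<and> c = 0"
  "prod_encode (Suc 0, c) = rec_code f \<longleftrightarrow> f = Succ \<and> c = 0"
  "prod_encode (2, c) = rec_code f \<longleftrightarrow> f = Proj c"
  "prod_encode (3, c) = rec_code f \<longleftrightarrow>
     (\<exists>g gs. f = Comp g gs \<and> c = prod_encode (rec_code g, list_encode (map rec_code gs)))"
  "prod_encode (4, c) = rec_code f \<longleftrightarrow>
     (\<exists>g h. f = PrimRec g h \<and> c = prod_encode (rec_code g, rec_code h))"
  "prod_encode (5, c) = rec_code f \<longleftrightarrow> (\<exists>g. f = Mu g \<and> c = rec_code g)"
  "prod_encode (6, c) = rec_code f \<longleftrightarrow> False"
  "prod_encode (7, c) = rec_code f \<longleftrightarrow> False"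
  by (cases f; auto simp: prod_encode_eq)+

abbreviation cons :: "nat \<Rightarrow> nat \<Rightarrow> nat" where
  "cons x xs \<equiv> Suc (prod_encode (x, xs))"

text \<open>Tag 6 marks a list of functions, evaluated componentwise. Tag 7 marks the condition in
  \<open>Mu f\<close> that \<open>f\<close> is positive at all arguments below \<open>y\<close>.\<close>

inductive derives :: "nat \<Rightarrow> nat \<Rightarrow> nat \<Rightarrow> bool" where
  zero: "derives (prod_encode (0, 0)) xs 0"
| succ: "derives (prod_encode (1, 0)) (cons x xs) (Suc x)"
| proj_0: "derives (prod_encode (2, 0)) (cons x xs) x"
| proj_Suc: "derives (prod_encode (2, i)) xs y \<Longrightarrow> derives (prod_encode (2, Suc i)) (cons x xs) y"
| comp: "derives (prod_encode (6, gs)) xs ys \<Longrightarrow> derives f ys z \<Longrightarrow>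
    derives (prod_encode (3, prod_encode (f, gs))) xs z"
| prim_rec_0: "derives f xs y \<Longrightarrow> derives (prod_encode (4, prod_encode (f, g))) (cons 0 xs) y"
| prim_rec_Suc: "derives (prod_encode (4, prod_encode (f, g))) (cons n xs) y \<Longrightarrow>
    derives g (cons n (cons y xs)) z \<Longrightarrow>
    derives (prod_encode (4, prod_encode (f, g))) (cons (Suc n) xs) z"
| mu: "derives f (cons n xs) 0 \<Longrightarrow> derives (prod_encode (7, f)) xs n \<Longrightarrow>
    derives (prod_encode (5, f)) xs n"
| list_Nil: "derives (prod_encode (6, 0)) xs 0"
| list_Cons: "derives g xs y \<Longrightarrow> derives (prod_encode (6, gs)) xs ys \<Longrightarrow>
    derives (prod_encode (6, cons g gs)) xs (cons y ys)"
| below_0: "derives (prod_encode (7, f)) xs 0"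
| below_Suc: "derives f (cons n xs) (Suc y) \<Longrightarrow> derives (prod_encode (7, f)) xs n \<Longrightarrow>
    derives (prod_encode (7, f)) xs (Suc n)"

lemma list_decode_cons [simp]: "list_decode (cons x xs) = x # list_decode xs"
  by simp

lemma list_encode_eq_cons_iff:
  "cons c d = list_encode (map rec_code gs) \<longleftrightarrow>
     (\<exists>f fs. gs = f # fs \<and> c = rec_code f \<and> d = list_encode (map rec_code fs))"
  by (cases gs) (auto simp: prod_encode_eq)

lemma list_encode_eq_0_iff: "0 = list_encode xs \<longleftrightarrow> xs = []"
  by (cases xs) auto

text \<open>The three claims treat function codes, tag 6 and tag 7; they have to be proved together
  because derivations pass from one kind to another. Nothing is claimed of numbers that are codes of
  neither kind.\<close>

lemma derives_sound:
  "derives c xs y \<Longrightarrow>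
    (\<forall>f. c = rec_code f \<longrightarrow> rec_eval f (list_decode xs) y) \<and>
    (\<forall>gs. c = prod_encode (6, list_encode (map rec_code gs)) \<longrightarrow>
      list_all2 (\<lambda>g z. rec_eval g (list_decode xs) z) gs (list_decode y)) \<and>
    (\<forall>f. c = prod_encode (7, rec_code f) \<longrightarrow>
      (\<forall>m<y. \<exists>z. rec_eval f (m # list_decode xs) (Suc z)))"
proof (induction rule: derives.induct)
  case (zero xs)
  then show ?case by (auto simp: rec_code_eq_iff prod_encode_eq intro: rec_eval.zero)
next
  case (succ x xs)
  then show ?case by (auto simp: rec_code_eq_iff prod_encode_eq intro: rec_eval.succ)
next
  case (proj_0 x xs)
  then show ?case using rec_eval.proj[of 0 "x # list_decode xs"]
    by (auto simp: rec_code_eq_iff prod_encode_eq)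
next
  case (proj_Suc i xs y x)
  then have "rec_eval (Proj i) (list_decode xs) y" by (simp add: rec_code_eq_iff)
  then have "i < length (list_decode xs)" "y = list_decode xs ! i"
    by (auto elim: rec_eval_elims)
  then have "rec_eval (Proj (Suc i)) (x # list_decode xs) y"
    using rec_eval.proj[of "Suc i" "x # list_decode xs"] by simp
  then show ?case by (auto simp: rec_code_eq_iff prod_encode_eq)
next
  case (comp gs xs ys f z)
  then show ?case
    by (auto simp: rec_code_eq_iff prod_encode_eq intro: rec_eval.comp)
next
  case (prim_rec_0 f xs y g)
  then show ?case by (auto simp: rec_code_eq_iff prod_encode_eq intro: rec_eval.prim_rec_0)
next
  case (prim_rec_Suc f g n xs y z)
  then show ?case
    by (auto simp: rec_code_eq_iff prod_encode_eq intro: rec_eval.prim_rec_Suc)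
next
  case (mu f n xs)
  then show ?case by (auto simp: rec_code_eq_iff prod_encode_eq intro!: rec_eval.mu)
next
  case (below_Suc f n xs y)
  then show ?case by (auto simp: rec_code_eq_iff prod_encode_eq less_Suc_eq)
qed (auto simp: rec_code_eq_iff prod_encode_eq list_encode_eq_cons_iff list_encode_eq_0_iff)

lemma derives_complete: "rec_eval f xs y \<Longrightarrow> derives (rec_code f) (list_encode xs) y"
proof (induction rule: rec_eval.induct)
  case (proj i xs)
  then show ?case
  proof (induction xs arbitrary: i)
    case (Cons x xs)
    then show ?case by (cases i) (auto intro: derives.proj_0 derives.proj_Suc)
  qed simp
next
  case (comp xs gs ys f z)
  have "derives (prod_encode (6, list_encode (map rec_code gs))) (list_encode xs) (list_encode ys)"
    using comp.IH(1) by (induction rule: list_all2_induct) (auto intro: derives.list_Nil derives.list_Cons)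
  with comp.IH(2) show ?case by (auto intro: derives.comp)
next
  case (mu f n xs)
  have "m \<le> n \<Longrightarrow> derives (prod_encode (7, rec_code f)) (list_encode xs) m" for m
  proof (induction m)
    case (Suc m)
    then obtain y where "derives (rec_code f) (list_encode (m # xs)) (Suc y)"
      using mu.IH(2) by (meson Suc_le_eq)
    with Suc show ?case by (auto intro: derives.below_Suc)
  qed (rule derives.below_0)
  with mu.IH(1) show ?case by (auto intro: derives.mu)
next
  case (prim_rec_Suc f g n xs y z)
  then show ?case by (auto intro: derives.prim_rec_Suc)
qed (auto intro: derives.intros simp: derives.succ[unfolded One_nat_def])

lemma derives_rec_code_iff: "derives (rec_code f) (list_encode xs) y \<longleftrightarrow> rec_eval f xs y"
  using derives_complete derives_sound by (metis list_encode_inverse)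

primrec num :: "nat \<Rightarrow> trm" where
  "num 0 = TZero"
| "num (Suc n) = TSuc (num n)"

lemma val_num [simp]: "val s (num n) = n"
  by (induction n) auto

lemma vars_num [simp]: "vars (num n) = {}"
  by (induction n) auto

abbreviation Cons_trm :: "trm \<Rightarrow> trm \<Rightarrow> trm" where
  "Cons_trm t u \<equiv> TSuc (TPair t u)"

abbreviation goal :: "trm \<Rightarrow> trm \<Rightarrow> trm \<Rightarrow> trm" where
  "goal f xs y \<equiv> TPair f (TPair xs y)"

section \<open>A logic program for evaluation, run by resolution on goal stacks\<close>

text \<open>The introduction rules of \<open>derives\<close> as Horn clauses, each a head with its
  list of premises. Variable numbers start at 3 because registers 0 and 1 hold the sides of a
  rewrite step and variable 2 is reserved for the rest of the stack.\<close>

definition clauses :: "(trm \<times> trm list) list" where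
  "clauses = (let f = TVar 3; g = TVar 4; xs = TVar 5; x = TVar 6; y = TVar 7; z = TVar 8 in
    [(goal (TPair (num 0) TZero) xs TZero, []),
     (goal (TPair (num 1) TZero) (Cons_trm x xs) (TSuc x), []),
     (goal (TPair (num 2) TZero) (Cons_trm x xs) x, []),
     (goal (TPair (num 2) (TSuc f)) (Cons_trm x xs) y, [goal (TPair (num 2) f) xs y]),
     (goal (TPair (num 3) (TPair f g)) xs z, [goal (TPair (num 6) g) xs y, goal f y z]),
     (goal (TPair (num 4) (TPair f g)) (Cons_trm TZero xs) y, [goal f xs y]),
     (goal (TPair (num 4) (TPair f g)) (Cons_trm (TSuc x) xs) z,
       [goal (TPair (num 4) (TPair f g)) (Cons_trm x xs) y, goal g (Cons_trm x (Cons_trm y xs)) z]),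
     (goal (TPair (num 5) f) xs x, [goal f (Cons_trm x xs) TZero, goal (TPair (num 7) f) xs x]),
     (goal (TPair (num 6) TZero) xs TZero, []),
     (goal (TPair (num 6) (Cons_trm f g)) xs (Cons_trm y z), [goal f xs y, goal (TPair (num 6) g) xs z]),
     (goal (TPair (num 7) f) xs TZero, []),
     (goal (TPair (num 7) f) xs (TSuc x), [goal f (Cons_trm x xs) (TSuc y), goal (TPair (num 7) f) xs x])])"

text \<open>One rewrite step is a resolution step: the top goal is matched with the head of a clause
  and replaced by the premises. The number 0 is the empty stack.\<close>

definition rules :: "(trm \<times> trm) list" where
  "rules = map (\<lambda>(h, ps). (Cons_trm h (TVar 2), foldr Cons_trm ps (TVar 2))) clauses"

lemma vars_rules: "(l, r) \<in> set rules \<Longrightarrow> vars l \<union> vars r \<subseteq> {2..}"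
  by (auto simp: rules_def clauses_def Let_def)

definition goal_holds :: "nat \<Rightarrow> bool" where
  "goal_holds g \<longleftrightarrow> (\<exists>c xs y. g = prod_encode (c, prod_encode (xs, y)) \<and> derives c xs y)"

lemma goal_holds_iff [simp]: "goal_holds (prod_encode (c, prod_encode (xs, y))) \<longleftrightarrow> derives c xs y"
  by (auto simp: goal_holds_def prod_encode_eq)

lemma clauses_sound:
  "(h, ps) \<in> set clauses \<Longrightarrow> \<forall>p\<in>set ps. goal_holds (val s p) \<Longrightarrow> goal_holds (val s h)"
  unfolding clauses_def Let_def
  by (auto intro: derives.intros simp: derives.succ[unfolded One_nat_def])

lemma list_decode_foldr_Cons_trm:
  "list_decode (val s (foldr Cons_trm ps t)) = map (val s) ps @ list_decode (val s t)"
  by (induction ps) auto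

text \<open>The empty stack satisfies the claim, and a step passes it backwards: true premises give
  a true head, and the goals below are untouched.\<close>

lemma rewrite_rules_sound:
  "(n, 0) \<in> (rewrite_rel rules)\<^sup>* \<Longrightarrow> \<forall>g\<in>set (list_decode n). goal_holds g"
proof (induction rule: converse_rtrancl_induct)
  case (step n m)
  from step(1) obtain s h ps where hp: "(h, ps) \<in> set clauses"
    and n: "n = val s (Cons_trm h (TVar 2))" and m: "m = val s (foldr Cons_trm ps (TVar 2))"
    unfolding rewrite_rel_def rules_def by auto
  from step.IH have "\<forall>p\<in>set ps. goal_holds (val s p)" "\<forall>g\<in>set (list_decode (s 2)). goal_holds g"
    unfolding m list_decode_foldr_Cons_trm by auto
  with clauses_sound[OF hp] show ?case by (simp add: n)
qed simp

text \<open>The arbitrary remainder \<open>E\<close> allows the runs for several premises to be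
  chained, each with the later premises below it.\<close>

definition solvable :: "nat \<Rightarrow> bool" where
  "solvable g \<longleftrightarrow> (\<forall>E. (cons g E, E) \<in> (rewrite_rel rules)\<^sup>*)"

lemma clause_solvable:
  assumes hp: "(h, ps) \<in> set clauses" and ps: "\<forall>p\<in>set ps. solvable (val s p)"
  shows "solvable (val s h)"
  unfolding solvable_def
proof
  fix E
  \<comment> \<open>Variable 2 occurs in no clause, so it can be set to the remaining stack without
    changing the values of head and premises.\<close>
  define u where "u = s(2 := E)"
  have v2: "2 \<notin> vars h \<and> (\<forall>p\<in>set ps. 2 \<notin> vars p)"
    using hp unfolding clauses_def Let_def by auto
  have h: "val u h = val s h"
    unfolding u_def using v2 by (intro val_cong) auto
  have p: "\<forall>p\<in>set ps. val u p = val s p"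
    unfolding u_def using v2 by (intro ballI val_cong) auto
  have [simp]: "u 2 = E" by (simp add: u_def)
  have "(Cons_trm h (TVar 2), foldr Cons_trm ps (TVar 2)) \<in> set rules"
    using hp unfolding rules_def by force
  then have "(val u (Cons_trm h (TVar 2)), val u (foldr Cons_trm ps (TVar 2))) \<in> rewrite_rel rules"
    unfolding rewrite_rel_def by blast
  moreover have "(val u (foldr Cons_trm ps (TVar 2)), E) \<in> (rewrite_rel rules)\<^sup>*"
    using ps p
  proof (induction ps)
    case (Cons q ps)
    then have "solvable (val u q)" by simp
    then have "(val u (foldr Cons_trm (q # ps) (TVar 2)), val u (foldr Cons_trm ps (TVar 2))) \<in> (rewrite_rel rules)\<^sup>*"
      by (simp add: solvable_def)
    moreover have "(val u (foldr Cons_trm ps (TVar 2)), E) \<in> (rewrite_rel rules)\<^sup>*"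
      using Cons by simp
    ultimately show ?case by (rule rtrancl_trans)
  qed simp
  ultimately show "(cons (val s h) E, E) \<in> (rewrite_rel rules)\<^sup>*"
    by (simp add: h converse_rtrancl_into_rtrancl)
qed

lemma derives_solvable: "derives c xs y \<Longrightarrow> solvable (prod_encode (c, prod_encode (xs, y)))"
proof (induction rule: derives.induct)
  case (zero xs)
  show ?case
    \<comment> \<open>The valuation is a list indexed by variable numbers: positions 3 to 8 are
      \<open>f\<close>, \<open>g\<close>, \<open>xs\<close>, \<open>x\<close>, \<open>y\<close>,
      \<open>z\<close> of \<open>clauses\<close>, as far as the clause needs them.\<close>
    using clause_solvable[of "fst (clauses ! 0)" "snd (clauses ! 0)" "(!) [0,0,0,0,0,xs]"]
    by (simp add: clauses_def Let_def)
next
  case (succ x xs)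
  show ?case
    using clause_solvable[of "fst (clauses ! 1)" "snd (clauses ! 1)" "(!) [0,0,0,0,0,xs,x]"]
    by (simp add: clauses_def Let_def)
next
  case (proj_0 x xs)
  show ?case
    using clause_solvable[of "fst (clauses ! 2)" "snd (clauses ! 2)" "(!) [0,0,0,0,0,xs,x]"]
    by (simp add: clauses_def Let_def)
next
  case (proj_Suc i xs y x)
  then show ?case
    using clause_solvable[of "fst (clauses ! 3)" "snd (clauses ! 3)" "(!) [0,0,0,i,0,xs,x,y]"]
    by (simp add: clauses_def Let_def)
next
  case (comp gs xs ys f z)
  then show ?case
    using clause_solvable[of "fst (clauses ! 4)" "snd (clauses ! 4)" "(!) [0,0,0,f,gs,xs,0,ys,z]"]
    by (auto simp: clauses_def Let_def)
next
  case (prim_rec_0 f xs y g)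
  then show ?case
    using clause_solvable[of "fst (clauses ! 5)" "snd (clauses ! 5)" "(!) [0,0,0,f,g,xs,0,y]"]
    by (auto simp: clauses_def Let_def)
next
  case (prim_rec_Suc f g n xs y z)
  then show ?case
    using clause_solvable[of "fst (clauses ! 6)" "snd (clauses ! 6)" "(!) [0,0,0,f,g,xs,n,y,z]"]
    by (auto simp: clauses_def Let_def)
next
  case (mu f n xs)
  then show ?case
    using clause_solvable[of "fst (clauses ! 7)" "snd (clauses ! 7)" "(!) [0,0,0,f,0,xs,n]"]
    by (auto simp: clauses_def Let_def)
next
  case (list_Nil xs)
  then show ?case
    using clause_solvable[of "fst (clauses ! 8)" "snd (clauses ! 8)" "(!) [0,0,0,0,0,xs]"]
    by (auto simp: clauses_def Let_def)
next
  case (list_Cons g xs y gs ys)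
  then show ?case
    using clause_solvable[of "fst (clauses ! 9)" "snd (clauses ! 9)" "(!) [0,0,0,g,gs,xs,0,y,ys]"]
    by (auto simp: clauses_def Let_def)
next
  case (below_0 f xs)
  then show ?case
    using clause_solvable[of "fst (clauses ! 10)" "snd (clauses ! 10)" "(!) [0,0,0,f,0,xs]"]
    by (auto simp: clauses_def Let_def)
next
  case (below_Suc f n xs y)
  then show ?case
    using clause_solvable[of "fst (clauses ! 11)" "snd (clauses ! 11)" "(!) [0,0,0,f,0,xs,n,y]"]
    by (auto simp: clauses_def Let_def)
qed

text \<open>A stack with a single goal, the diagonal one: the function with code \<open>n\<close>
  takes the value 0 on the list consisting of \<open>n\<close>.\<close>

definition query :: "nat \<Rightarrow> nat" where
  "query n = cons (prod_encode (n, prod_encode (cons n 0, 0))) 0"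

lemma rewrite_query_iff:
  "(query (rec_code f), 0) \<in> (rewrite_rel rules)\<^sup>* \<longleftrightarrow> rec_eval f [rec_code f] 0"
proof -
  have "rec_eval f [rec_code f] 0 \<longleftrightarrow> derives (rec_code f) (cons (rec_code f) 0) 0"
    using derives_rec_code_iff[of f "[rec_code f]" 0] by simp
  also have "\<dots> \<longleftrightarrow> (query (rec_code f), 0) \<in> (rewrite_rel rules)\<^sup>*"
  proof
    assume "derives (rec_code f) (cons (rec_code f) 0) 0"
    then show "(query (rec_code f), 0) \<in> (rewrite_rel rules)\<^sup>*"
      using derives_solvable unfolding query_def solvable_def by blast
  next
    assume "(query (rec_code f), 0) \<in> (rewrite_rel rules)\<^sup>*"
    from rewrite_rules_sound[OF this] show "derives (rec_code f) (cons (rec_code f) 0) 0"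
      by (simp add: query_def)
  qed
  finally show ?thesis by simp
qed

section \<open>Counter programs on a circular queue\<close>

definition number :: "nat \<Rightarrow> nat list \<Rightarrow> nat" where
  "number k = foldl (\<lambda>n d. n * k + d) 0"

lemma number_Nil [simp]: "number k [] = 0"
  by (simp add: number_def)

lemma number_snoc [simp]: "number k (xs @ [d]) = number k xs * k + d"
  by (simp add: number_def)

lemma number_append: "number k (xs @ ys) = number k xs * k ^ length ys + number k ys"
proof (induction ys rule: rev_induct)
  case (snoc y ys)
  then show ?case by (simp flip: append_assoc add: algebra_simps)
qed simp

lemma number_replicate_0: "number k (replicate p 0) = 0"
  by (induction p) (simp_all add: replicate_append_same[symmetric] del: replicate_Suc add: replicate_Suc)

lemma number_inj_length:
  assumes "length xs = length ys" "set xs \<subseteq> {..<k}" "set ys \<subseteq> {..<k}" "number k xs = number k ys"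
  shows "xs = ys"
  using assms
proof (induction xs arbitrary: ys rule: rev_induct)
  case (snoc x xs)
  then obtain y ys' where ys: "ys = ys' @ [y]" by (cases ys rule: rev_cases) auto
  have xy: "x < k" "y < k" using snoc.prems ys by auto
  have eq: "number k xs * k + x = number k ys' * k + y" using snoc.prems ys by simp
  have "x = (number k xs * k + x) mod k" "y = (number k ys' * k + y) mod k" using xy by simp_all
  then have "x = y" using eq by metis
  with eq xy have "number k xs = number k ys'" by simp
  with snoc ys \<open>x = y\<close> show ?case by auto
qed simp

text \<open>Padding the shorter word with zeros does not change its number and reduces the claim to
  words of equal length.\<close>

lemma number_inj:
  assumes "set xs \<subseteq> {..<k}" "set ys \<subseteq> {..<k}" "number k xs = number k ys" "length xs \<le> length ys"
  shows "ys = replicate (length ys - length xs) 0 @ xs"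
proof (rule number_inj_length[symmetric])
  show "number k (replicate (length ys - length xs) 0 @ xs) = number k ys"
    using assms(3) by (simp add: number_append number_replicate_0)
  \<comment> \<open>Zero has to be a digit if it is added: a nonempty \<open>ys\<close> has a digit
    below \<open>k\<close>, hence \<open>0 < k\<close>, and for an empty \<open>ys\<close> nothing
    is added.\<close>
  show "set (replicate (length ys - length xs) 0 @ xs) \<subseteq> {..<k}"
    using assms by (cases ys) auto
qed (use assms in auto)

section \<open>Instructions as revolutions of the queue\<close>

text \<open>A letter \<open>Digit a b\<close> reads \<open>a\<close> at the head of the queue and writes \<open>b\<close> at its end.\<close>

datatype atom = Digit (rd: nat) (wr: nat) | Transfer | Cancel

definition digits :: "atom set" where
  "digits = {Digit a b | a b. True}"

definition idle :: "nat list \<Rightarrow> atom rx" where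
  "idle ds = Star (Sym (map (\<lambda>d. Digit d d) ds))"

text \<open>The queue is a word over the letters \<open>0, \<dots>, m\<close> followed by the separator \<open>m + 1\<close>. The value of
  register \<open>r\<close> is the number of letters \<open>r + 1\<close>, and the letter \<open>0\<close> is free space.\<close>

definition revolve :: "nat \<Rightarrow> nat \<Rightarrow> nat \<Rightarrow> atom rx" where
  "revolve m a b = Seq (idle [0..<Suc m]) (Seq (Do (Digit a b))
     (Seq (idle [0..<Suc m]) (Do (Digit (Suc m) (Suc m)))))"

text \<open>An increment turns one blank into the letter of the register, at any position, and a
  decrement does the reverse. A zero test copies the queue over an alphabet from which that letter
  is missing. Every block ends by passing the separator, so it lasts exactly one revolution.\<close>

primrec block :: "nat \<Rightarrow> action \<Rightarrow> atom rx" where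
  "block m (Inc r) = revolve m 0 (Suc r)"
| "block m (Dec r) = revolve m (Suc r) 0"
| "block m (Zer r) = Seq (idle (removeAll (Suc r) [0..<Suc m])) (Do (Digit (Suc m) (Suc m)))"

primrec reg :: "action \<Rightarrow> nat" where
  "reg (Inc r) = r" | "reg (Dec r) = r" | "reg (Zer r) = r"

definition store :: "nat list \<Rightarrow> nat \<Rightarrow> nat" where
  "store X r = count_list X (Suc r)"

lemma matches_idle_iff:
  "matches (idle ds) w \<longleftrightarrow> (\<exists>u. set u \<subseteq> set ds \<and> w = map (\<lambda>d. Digit d d) u)"
proof
  assume "matches (idle ds) w"
  then have "set w \<subseteq> (\<lambda>d. Digit d d) ` set ds" by (simp add: idle_def matches_Star_Sym_iff)
  then show "\<exists>u. set u \<subseteq> set ds \<and> w = map (\<lambda>d. Digit d d) u"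
    by (intro exI[of _ "map rd w"]) (auto simp: map_idI intro!: map_idI[symmetric])
next
  show "matches (idle ds) w" if "\<exists>u. set u \<subseteq> set ds \<and> w = map (\<lambda>d. Digit d d) u"
    using that unfolding idle_def matches_Star_Sym_iff by force
qed

lemma matches_revolve_iff:
  "matches (revolve m a b) w \<longleftrightarrow> (\<exists>u v. set u \<subseteq> {..m} \<and> set v \<subseteq> {..m} \<and>
     w = map (\<lambda>d. Digit d d) u @ [Digit a b] @ map (\<lambda>d. Digit d d) v @ [Digit (Suc m) (Suc m)])"
proof -
  have "set [0..<Suc m] = {..m}" by auto
  then show ?thesis
    unfolding revolve_def matches_Seq_iff matches_idle_iff matches_Sym_iff
    by (simp del: upt_Suc) blast
qed

lemma set_removeAll_upt: "set (removeAll x [0..<Suc m]) = {..m} - {x}"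
  by (auto simp only: set_removeAll set_upt atLeast0LessThan lessThan_Suc_atMost)

lemma block_sound:
  assumes "matches (block m a) w" "reg a < m"
  shows "\<exists>X Y. map rd w = X @ [Suc m] \<and> map wr w = Y @ [Suc m] \<and> set X \<subseteq> {..m} \<and> set Y \<subseteq> {..m} \<and>
    (store X, store Y) \<in> act a \<and> set w \<subseteq> digits"
proof (cases a)
  case (Inc r)
  with assms obtain u v where uv: "set u \<subseteq> {..m}" "set v \<subseteq> {..m}" and
    w: "w = map (\<lambda>d. Digit d d) u @ [Digit 0 (Suc r)] @ map (\<lambda>d. Digit d d) v @ [Digit (Suc m) (Suc m)]"
    by (auto simp: matches_revolve_iff)
  show ?thesis
    by (intro exI[of _ "u @ 0 # v"] exI[of _ "u @ Suc r # v"])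
      (use uv assms(2) in \<open>auto simp: w Inc comp_def store_def fun_eq_iff digits_def\<close>)
next
  case (Dec r)
  with assms obtain u v where uv: "set u \<subseteq> {..m}" "set v \<subseteq> {..m}" and
    w: "w = map (\<lambda>d. Digit d d) u @ [Digit (Suc r) 0] @ map (\<lambda>d. Digit d d) v @ [Digit (Suc m) (Suc m)]"
    by (auto simp: matches_revolve_iff)
  show ?thesis
    by (intro exI[of _ "u @ Suc r # v"] exI[of _ "u @ 0 # v"])
      (use uv assms(2) in \<open>auto simp: w Dec comp_def store_def fun_eq_iff digits_def\<close>)
next
  case (Zer r)
  from assms(1) obtain u where "set u \<subseteq> set (removeAll (Suc r) [0..<Suc m])" and
    w: "w = map (\<lambda>d. Digit d d) u @ [Digit (Suc m) (Suc m)]"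
    unfolding Zer block.simps matches_Seq_iff matches_idle_iff matches_Sym_iff by auto
  then have u: "set u \<subseteq> {..m}" "Suc r \<notin> set u" unfolding set_removeAll_upt by auto
  show ?thesis
    by (intro exI[of _ u]) (use u in \<open>auto simp: w Zer comp_def store_def digits_def\<close>)
qed

text \<open>The last conjunct says that an instruction uses up at most one blank; it makes one blank
  per instruction a sufficient supply.\<close>

lemma block_complete:
  assumes X: "set X \<subseteq> {..m}" and act: "(store X, s) \<in> act a" and reg: "reg a < m" and "0 \<in> set X"
  shows "\<exists>w Y. matches (block m a) w \<and> map rd w = X @ [Suc m] \<and> map wr w = Y @ [Suc m] \<and>
    set Y \<subseteq> {..m} \<and> store Y = s \<and> count_list X 0 \<le> Suc (count_list Y 0)"
proof (cases a)
  case (Inc r)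
  obtain u v where X_eq: "X = u @ 0 # v" using \<open>0 \<in> set X\<close> by (meson split_list)
  show ?thesis
  proof (intro exI[of _ "map (\<lambda>d. Digit d d) u @ [Digit 0 (Suc r)] @ map (\<lambda>d. Digit d d) v @
        [Digit (Suc m) (Suc m)]"] exI[of _ "u @ Suc r # v"] conjI)
    show "matches (block m a) (map (\<lambda>d. Digit d d) u @ [Digit 0 (Suc r)] @ map (\<lambda>d. Digit d d) v @
        [Digit (Suc m) (Suc m)])"
      unfolding Inc block.simps matches_revolve_iff
      using X X_eq by (intro exI[of _ u] exI[of _ v]) simp
    show "store (u @ Suc r # v) = s"
      using act by (auto simp: Inc X_eq store_def fun_eq_iff)
  qed (use X reg in \<open>auto simp: Inc X_eq comp_def\<close>)
next
  case (Dec r)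
  have "Suc r \<in> set X"
  proof (rule ccontr)
    assume "Suc r \<notin> set X"
    then have "store X r = 0" by (simp add: store_def)
    with act Dec show False by simp
  qed
  then obtain u v where X_eq: "X = u @ Suc r # v" by (meson split_list)
  show ?thesis
  proof (intro exI[of _ "map (\<lambda>d. Digit d d) u @ [Digit (Suc r) 0] @ map (\<lambda>d. Digit d d) v @
        [Digit (Suc m) (Suc m)]"] exI[of _ "u @ 0 # v"] conjI)
    show "matches (block m a) (map (\<lambda>d. Digit d d) u @ [Digit (Suc r) 0] @ map (\<lambda>d. Digit d d) v @
        [Digit (Suc m) (Suc m)])"
      unfolding Dec block.simps matches_revolve_iff
      using X X_eq by (intro exI[of _ u] exI[of _ v]) simp
    show "store (u @ 0 # v) = s"
      using act by (auto simp: Dec X_eq store_def fun_eq_iff)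
  qed (use X reg in \<open>auto simp: Dec X_eq comp_def\<close>)
next
  case (Zer r)
  with act have "Suc r \<notin> set X" by (simp add: store_def count_list_0_iff)
  then have "set X \<subseteq> set (removeAll (Suc r) [0..<Suc m])"
    using X unfolding set_removeAll_upt by auto
  then have "matches (block m a) (map (\<lambda>d. Digit d d) X @ [Digit (Suc m) (Suc m)])"
    unfolding Zer block.simps matches_Seq_iff matches_idle_iff matches_Sym_iff
    by (intro exI[of _ "map (\<lambda>d. Digit d d) X"] exI[of _ "[Digit (Suc m) (Suc m)]"] conjI
        exI[of _ X]) simp_all
  then show ?thesis
    by (intro exI[of _ "map (\<lambda>d. Digit d d) X @ [Digit (Suc m) (Suc m)]"] exI[of _ X])
      (use X act in \<open>auto simp: Zer comp_def\<close>)
qed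

lemma append_sep_eq_iff:
  "x \<notin> set us \<Longrightarrow> x \<notin> set vs \<Longrightarrow> us @ x # ys = vs @ x # zs \<longleftrightarrow> us = vs \<and> ys = zs"
  by (induction us arbitrary: vs; case_tac vs) auto

text \<open>The first separators on both sides must coincide. Hence the first block reads exactly
  the current content \<open>X\<close>, and cancelling it leaves the same equation for the content
  \<open>Y\<close> that this block has written. So the single equation forces all blocks to fit
  together.\<close>

lemma blocks_sound:
  assumes "list_all2 (\<lambda>a. matches (block m a)) as ws" "\<forall>a\<in>set as. reg a < m"
    "X @ Suc m # map wr (concat ws) = map rd (concat ws) @ f" "set X \<subseteq> {..m}"
  shows "\<exists>s. (store X, s) \<in> path act as"
  using assms
proof (induction as ws arbitrary: X rule: list_all2_induct)
  case (Cons a as w ws)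
  obtain X' Y where w: "map rd w = X' @ [Suc m]" "map wr w = Y @ [Suc m]" "set X' \<subseteq> {..m}"
    "set Y \<subseteq> {..m}" "(store X', store Y) \<in> act a"
    using block_sound[OF Cons(1)] Cons.prems by auto
  have "X @ Suc m # (Y @ Suc m # map wr (concat ws)) = X' @ Suc m # (map rd (concat ws) @ f)"
    using Cons.prems(2) w by simp
  moreover have "Suc m \<notin> set X" "Suc m \<notin> set X'" using Cons.prems(3) w(3) by auto
  ultimately have "X = X'" "Y @ Suc m # map wr (concat ws) = map rd (concat ws) @ f"
    using append_sep_eq_iff[of "Suc m" X X' "Y @ Suc m # map wr (concat ws)" "map rd (concat ws) @ f"]
    by auto
  with Cons.IH[of Y] Cons.prems w show ?case by (auto simp: relcomp_unfold)
qed auto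

lemma blocks_complete:
  assumes "(store X, s) \<in> path act as" "\<forall>a\<in>set as. reg a < m" "set X \<subseteq> {..m}"
    "length as \<le> count_list X 0"
  shows "\<exists>ws f. list_all2 (\<lambda>a. matches (block m a)) as ws \<and>
    X @ Suc m # map wr (concat ws) = map rd (concat ws) @ f \<and> set f \<subseteq> {..Suc m}"
  using assms
proof (induction as arbitrary: X)
  case Nil
  \<comment> \<open>Without further instructions, the whole queue with its separator is the
    leftover.\<close>
  then show ?case by (intro exI[of _ "[]"] exI[of _ "X @ [Suc m]"]) auto
next
  case (Cons a as)
  then obtain s1 where s1: "(store X, s1) \<in> act a" "(s1, s) \<in> path act as" by auto
  have "0 \<in> set X"
  proof (rule ccontr)
    assume "0 \<notin> set X"
    then show False using Cons.prems(4) by simp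
  qed
  then obtain w Y where w: "matches (block m a) w" "map rd w = X @ [Suc m]" "map wr w = Y @ [Suc m]"
    "set Y \<subseteq> {..m}" "store Y = s1" "count_list X 0 \<le> Suc (count_list Y 0)"
    using block_complete[OF Cons.prems(3) s1(1)] Cons.prems(2) by auto
  with Cons.IH[of Y] Cons.prems s1 obtain ws f where
    "list_all2 (\<lambda>a. matches (block m a)) as ws"
    "Y @ Suc m # map wr (concat ws) = map rd (concat ws) @ f" "set f \<subseteq> {..Suc m}"
    by auto
  with w show ?case by (intro exI[of _ "w # ws"] exI[of _ f]) auto
qed

section \<open>The queue as a vector of three integers\<close>

text \<open>With \<open>k\<close> letters, a run multiplies the first two entries by \<open>k\<close> while appending the letter read
  to the first and the letter written to the second. If \<open>w\<close> and \<open>w'\<close> are the words read and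
  written, the second entry is then moved to the third, which the matrix fixes, so that the
  queue content \<open>f\<close> that is left over can be appended to the first alone. Reaching \<open>0\<close> means
  that \<open>c w'\<close> and \<open>w f\<close> denote the same number in base \<open>k\<close>, where \<open>c\<close> is the initial queue.\<close>

primrec triple_rel :: "nat \<Rightarrow> atom \<Rightarrow> ((int \<times> int \<times> int) \<times> (int \<times> int \<times> int)) set" where
  "triple_rel k (Digit a b) = {((x, y, z), (int k * x + int a, int k * y + int b, z)) | x y z. True}"
| "triple_rel k Transfer = {((x, y, z), (x, y - 1, z + 1)) | x y z. True}"
| "triple_rel k Cancel = {((x, y, z), (x - 1, y, z - 1)) | x y z. True}"

text \<open>The loops stop at guessed moments, but the target forces the guesses. Appending
  \<open>f\<close> also multiplies the second entry by \<open>k\<close>, so it ends at 0 only if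
  \<open>Transfer\<close> has emptied it completely. \<open>Cancel\<close> lowers the first and the
  third entry together, so both vanish only if they were equal.\<close>

definition queue_rx :: "nat \<Rightarrow> action rx \<Rightarrow> atom rx" where
  "queue_rx m c = Seq (subst (block m) c) (Seq (Star (Do Transfer))
     (Seq (Star (Sym (map (\<lambda>d. Digit d 0) [0..<m + 2]))) (Star (Do Cancel))))"

lemma path_digits:
  "set w \<subseteq> digits \<Longrightarrow> ((x, y, z), t) \<in> path (triple_rel k) w \<longleftrightarrow>
    t = (x * int k ^ length w + int (number k (map rd w)),
         y * int k ^ length w + int (number k (map wr w)), z)"
proof (induction w arbitrary: t rule: rev_induct)
  case (snoc a w)
  then obtain b c where "a = Digit b c" by (auto simp: digits_def)
  with snoc show ?case by (auto simp: path_append relcomp_unfold algebra_simps)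
qed auto

lemma den_Star_Transfer:
  "((x, y, z), t) \<in> den (triple_rel k) (Star (Do Transfer)) \<longleftrightarrow>
    (\<exists>j::nat. t = (x, y - int j, z + int j))"
proof
  assume "((x, y, z), t) \<in> den (triple_rel k) (Star (Do Transfer))"
  then have "((x, y, z), t) \<in> (triple_rel k Transfer)\<^sup>*" by simp
  then show "\<exists>j::nat. t = (x, y - int j, z + int j)"
  proof (induction rule: rtrancl_induct)
    case base
    show ?case by (intro exI[of _ 0]) simp
  next
    case (step t u)
    then obtain j :: nat where "t = (x, y - int j, z + int j)" by blast
    with step(2) show ?case by (intro exI[of _ "Suc j"]) auto
  qed
next
  have "((x, y, z), (x, y - int j, z + int j)) \<in> (triple_rel k Transfer)\<^sup>*" for j :: nat
  proof (induction j)
    case (Suc j)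
    have "((x, y - int j, z + int j), (x, y - int (Suc j), z + int (Suc j))) \<in> triple_rel k Transfer"
      by auto
    with Suc show ?case by (rule rtrancl_into_rtrancl)
  qed simp
  then show "((x, y, z), t) \<in> den (triple_rel k) (Star (Do Transfer))"
    if "\<exists>j::nat. t = (x, y - int j, z + int j)" using that by auto
qed

lemma den_Star_Cancel:
  "((x, y, z), t) \<in> den (triple_rel k) (Star (Do Cancel)) \<longleftrightarrow>
    (\<exists>j::nat. t = (x - int j, y, z - int j))"
proof
  assume "((x, y, z), t) \<in> den (triple_rel k) (Star (Do Cancel))"
  then have "((x, y, z), t) \<in> (triple_rel k Cancel)\<^sup>*" by simp
  then show "\<exists>j::nat. t = (x - int j, y, z - int j)"
  proof (induction rule: rtrancl_induct)
    case base
    show ?case by (intro exI[of _ 0]) simp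
  next
    case (step t u)
    then obtain j :: nat where "t = (x - int j, y, z - int j)" by blast
    with step(2) show ?case by (intro exI[of _ "Suc j"]) auto
  qed
next
  have "((x, y, z), (x - int j, y, z - int j)) \<in> (triple_rel k Cancel)\<^sup>*" for j :: nat
  proof (induction j)
    case (Suc j)
    have "((x - int j, y, z - int j), (x - int (Suc j), y, z - int (Suc j))) \<in> triple_rel k Cancel"
      by auto
    with Suc show ?case by (rule rtrancl_into_rtrancl)
  qed simp
  then show "((x, y, z), t) \<in> den (triple_rel k) (Star (Do Cancel))"
    if "\<exists>j::nat. t = (x - int j, y, z - int j)" using that by auto
qed

lemma den_rest:
  "((x, y, z), t) \<in> den (triple_rel k) (Star (Sym (map (\<lambda>d. Digit d 0) [0..<k]))) \<longleftrightarrow>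
    (\<exists>f. set f \<subseteq> {..<k} \<and> t = (x * int k ^ length f + int (number k f), y * int k ^ length f, z))"
proof -
  have "number k (map (\<lambda>_. 0) f) = 0" for f :: "nat list"
    using number_replicate_0[of k "length f"] by (simp add: map_replicate_const)
  then have run: "((x, y, z), t) \<in> path (triple_rel k) (map (\<lambda>d. Digit d 0) f) \<longleftrightarrow>
     t = (x * int k ^ length f + int (number k f), y * int k ^ length f, z)" for f
    by (subst path_digits) (auto simp: digits_def comp_def)
  have words: "matches (Star (Sym (map (\<lambda>d. Digit d 0) [0..<k]))) w \<longleftrightarrow>
      (\<exists>f. set f \<subseteq> {..<k} \<and> w = map (\<lambda>d. Digit d 0) f)" for w
  proof
    assume "matches (Star (Sym (map (\<lambda>d. Digit d 0) [0..<k]))) w"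
    then have "set w \<subseteq> (\<lambda>d. Digit d 0) ` {..<k}" by (auto simp: matches_Star_Sym_iff)
    then show "\<exists>f. set f \<subseteq> {..<k} \<and> w = map (\<lambda>d. Digit d 0) f"
      by (intro exI[of _ "map rd w"]) (auto intro!: map_idI[symmetric])
  qed (force simp: matches_Star_Sym_iff)
  show ?thesis
    unfolding den_eq_path words run[symmetric] by (metis (no_types))
qed

lemma queue_run_iff:
  assumes W: "\<And>w. matches (subst (block m) c) w \<Longrightarrow> set w \<subseteq> digits"
  shows "((0, int C, 0), (0, 0, 0)) \<in> den (triple_rel (m + 2)) (queue_rx m c) \<longleftrightarrow>
    (\<exists>w f. matches (subst (block m) c) w \<and> set f \<subseteq> {..<m + 2} \<and>
      number (m + 2) (map rd w @ f) = C * (m + 2) ^ length w + number (m + 2) (map wr w))"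
    (is "?L \<longleftrightarrow> ?R")
proof -
  define k where "k = m + 2"
  have digits: "((0, int C, 0), t) \<in> path (triple_rel k) w \<longleftrightarrow>
      t = (int (number k (map rd w)), int C * int k ^ length w + int (number k (map wr w)), 0)"
    if "matches (subst (block m) c) w" for w t
    using path_digits[OF W[OF that], of 0 "int C" 0 t k] by simp
  have word: "((0, int C, 0), t) \<in> den (triple_rel k) (subst (block m) c) \<longleftrightarrow>
      (\<exists>w. matches (subst (block m) c) w \<and>
        t = (int (number k (map rd w)), int C * int k ^ length w + int (number k (map wr w)), 0))" for t
    unfolding den_eq_path using digits by blast
  show ?thesis
    unfolding k_def[symmetric]
  proof
    assume "((0, int C, 0), (0, 0, 0)) \<in> den (triple_rel k) (queue_rx m c)"
    then obtain t1 t2 t3 where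
      1: "((0, int C, 0), t1) \<in> den (triple_rel k) (subst (block m) c)" and
      2: "(t1, t2) \<in> den (triple_rel k) (Star (Do Transfer))" and
      3: "(t2, t3) \<in> den (triple_rel k) (Star (Sym (map (\<lambda>d. Digit d 0) [0..<k])))" and
      4: "(t3, (0, 0, 0)) \<in> den (triple_rel k) (Star (Do Cancel))"
      unfolding queue_rx_def den_Seq_iff k_def[symmetric] by blast
    from 1 obtain w where w: "matches (subst (block m) c) w" and
      t1: "t1 = (int (number k (map rd w)), int C * int k ^ length w + int (number k (map wr w)), 0)"
      unfolding word by blast
    from 2 obtain j :: nat where t2: "t2 = (int (number k (map rd w)),
        int C * int k ^ length w + int (number k (map wr w)) - int j, 0 + int j)"
      unfolding t1 den_Star_Transfer by blast
    from 3 obtain f where f: "set f \<subseteq> {..<k}" and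
      t3: "t3 = (int (number k (map rd w)) * int k ^ length f + int (number k f),
        (int C * int k ^ length w + int (number k (map wr w)) - int j) * int k ^ length f, 0 + int j)"
      unfolding t2 den_rest by blast
    from 4 obtain i :: nat where "(0, 0, 0) =
       (int (number k (map rd w)) * int k ^ length f + int (number k f) - int i,
        (int C * int k ^ length w + int (number k (map wr w)) - int j) * int k ^ length f, 0 + int j - int i)"
      unfolding t3 den_Star_Cancel by blast
    then have i: "int (number k (map rd w)) * int k ^ length f + int (number k f) = int i" "i = j"
      and "(int C * int k ^ length w + int (number k (map wr w)) - int j) * int k ^ length f = 0"
      unfolding prod.inject by linarith+
    \<comment> \<open>As \<open>k\<close> is nonzero, the second entry was already 0 before
      \<open>f\<close> was appended, so \<open>Transfer\<close> ran as often as its value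
      demands.\<close>
    moreover have "int k ^ length f \<noteq> 0" by (simp add: k_def)
    ultimately have j: "int C * int k ^ length w + int (number k (map wr w)) = int j"
      by (metis eq_iff_diff_eq_0 mult_eq_0_iff)
    have "int (number k (map rd w @ f)) = int i"
      unfolding i(1)[symmetric] by (simp add: number_append)
    moreover have "int (C * k ^ length w + number k (map wr w)) = int j"
      unfolding j[symmetric] by simp
    ultimately have "number k (map rd w @ f) = C * k ^ length w + number k (map wr w)"
      using i(2) by (metis of_nat_eq_iff)
    with w f show "\<exists>w f. matches (subst (block m) c) w \<and> set f \<subseteq> {..<k} \<and>
      number k (map rd w @ f) = C * k ^ length w + number k (map wr w)" by blast
  next
    assume "\<exists>w f. matches (subst (block m) c) w \<and> set f \<subseteq> {..<k} \<and>
      number k (map rd w @ f) = C * k ^ length w + number k (map wr w)"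
    then obtain w f where w: "matches (subst (block m) c) w" and f: "set f \<subseteq> {..<k}"
      and eq: "number k (map rd w @ f) = C * k ^ length w + number k (map wr w)" by blast
    \<comment> \<open>The common value of both sides is the number of rounds of
      \<open>Transfer\<close> and of \<open>Cancel\<close> alike.\<close>
    define j where "j = number k (map rd w @ f)"
    have j1: "int (number k (map rd w)) * int k ^ length f + int (number k f) = int j"
      by (simp add: j_def number_append)
    have j2: "int C * int k ^ length w + int (number k (map wr w)) = int j"
      using eq by (simp add: j_def)
    have "((0, int C, 0), (int (number k (map rd w)), int j, 0)) \<in> den (triple_rel k) (subst (block m) c)"
      unfolding word using w j2 by auto
    moreover have "((int (number k (map rd w)), int j, 0), (int (number k (map rd w)), 0, int j))
        \<in> den (triple_rel k) (Star (Do Transfer))"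
      unfolding den_Star_Transfer by (intro exI[of _ j]) simp
    moreover have "((int (number k (map rd w)), 0, int j), (int j, 0, int j))
        \<in> den (triple_rel k) (Star (Sym (map (\<lambda>d. Digit d 0) [0..<k])))"
      unfolding den_rest using f j1 by (intro exI[of _ f]) simp
    moreover have "((int j, 0, int j), (0, 0, 0)) \<in> den (triple_rel k) (Star (Do Cancel))"
      unfolding den_Star_Cancel by (intro exI[of _ j]) simp
    ultimately show "((0, int C, 0), (0, 0, 0)) \<in> den (triple_rel k) (queue_rx m c)"
      unfolding queue_rx_def den_Seq_iff k_def[symmetric] by blast
  qed
qed

lemma count_list_replicate: "count_list (replicate n x) y = (if x = y then n else 0)"
  by (induction n) auto

text \<open>The queue initially holds \<open>n\<close> letters 1, so register 0 has value
  \<open>n\<close>. The equation between numbers becomes one between words up to leading zeros,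
  which serve as blanks; the final store is free because the leftover \<open>f\<close> is.\<close>

lemma queue_correct:
  assumes reg: "\<And>a. a \<in> set_rx c \<Longrightarrow> reg a < m" and "0 < m"
  shows "((0, int (number (m + 2) (replicate n 1 @ [Suc m])), 0), (0, 0, 0))
      \<in> den (triple_rel (m + 2)) (queue_rx m c) \<longleftrightarrow> (\<exists>t. ((\<lambda>_. 0)(0 := n), t) \<in> exec c)"
proof -
  define k where "k = m + 2"
  have matches_reg: "\<forall>a\<in>set as. reg a < m" if "matches c as" for as
  proof -
    have "set as \<subseteq> set_rx c" using that by (induction rule: matches.induct) auto
    with reg show ?thesis by blast
  qed
  have W: "set w \<subseteq> digits \<and> set (map rd w) \<subseteq> {..<k} \<and> set (map wr w) \<subseteq> {..<k}"
    if "matches (subst (block m) c) w" for w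
  proof -
    from matches_subst_elim[OF that] obtain as ws where as: "matches c as"
      "list_all2 (\<lambda>a. matches (block m a)) as ws" "w = concat ws" by blast
    from as(2) matches_reg[OF as(1)] show ?thesis unfolding as(3)
    proof (induction rule: list_all2_induct)
      case (Cons a as v vs)
      then obtain X Y where "map rd v = X @ [Suc m]" "map wr v = Y @ [Suc m]" "set X \<subseteq> {..m}"
        "set Y \<subseteq> {..m}" "set v \<subseteq> digits"
        using block_sound[OF Cons(1)] by auto
      then have "set v \<subseteq> digits" "set (map rd v) \<subseteq> {..<k}" "set (map wr v) \<subseteq> {..<k}"
        by (simp_all only: set_append k_def) auto
      with Cons show ?case by auto
    qed simp
  qed
  define init where "init = replicate n 1 @ [Suc m]"
  have init: "set init \<subseteq> {..<k}" by (auto simp: init_def k_def)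
  \<comment> \<open>The first letter is 1, or the separator if \<open>n\<close> is 0. So zeros can
    be missing only in front of the initial queue, never in front of the word read.\<close>
  have hd_init: "hd (init @ ys) \<noteq> 0" for ys
    by (cases n) (auto simp: init_def)
  have store: "store (replicate p 0 @ replicate n 1) = (\<lambda>_. 0)(0 := n)" for p
    by (auto simp: store_def fun_eq_iff count_list_replicate)
  have letters: "set (replicate p 0 @ replicate n 1) \<subseteq> {..m}" for p
    using \<open>0 < m\<close> by auto
  have run: "number k (map rd w @ f) = number k init * k ^ length w + number k (map wr w) \<longleftrightarrow>
      (\<exists>p. (replicate p 0 @ replicate n 1) @ Suc m # map wr w = map rd w @ f)"
    if w: "matches (subst (block m) c) w" and f: "set f \<subseteq> {..<k}" for w f
  proof -
    let ?l = "init @ map wr w" and ?r = "map rd w @ f"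
    have sub: "set ?l \<subseteq> {..<k}" "set ?r \<subseteq> {..<k}" using W[OF w] f init by auto
    have "number k ?l = number k ?r \<longleftrightarrow> (\<exists>p. replicate p 0 @ ?l = ?r)"
    proof
      assume eq: "number k ?l = number k ?r"
      show "\<exists>p. replicate p 0 @ ?l = ?r"
      proof (cases "length ?l \<le> length ?r")
        case True
        from number_inj[OF sub eq this] show ?thesis by metis
      next
        case False
        then have "?l = replicate (length ?l - length ?r) 0 @ ?r"
          using number_inj[OF sub(2,1) eq[symmetric]] by simp
        moreover obtain p where "length ?l - length ?r = Suc p" using False by (metis Suc_diff_le diff_is_0_eq not0_implies_Suc)
        ultimately have "hd ?l = 0" by (metis append_Cons list.sel(1) replicate_Suc)
        with hd_init show ?thesis by blast
      qed
    next
      show "number k ?l = number k ?r" if "\<exists>p. replicate p 0 @ ?l = ?r"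
      proof -
        from that obtain p where "?r = replicate p 0 @ ?l" by metis
        then show ?thesis by (simp add: number_append[of k "replicate p 0"] number_replicate_0)
      qed
    qed
    moreover have "number k ?l = number k init * k ^ length w + number k (map wr w)"
      by (simp add: number_append)
    ultimately show ?thesis by (auto simp: init_def)
  qed
  have "((0, int (number k init), 0), (0, 0, 0)) \<in> den (triple_rel k) (queue_rx m c) \<longleftrightarrow>
      (\<exists>w f p. matches (subst (block m) c) w \<and> set f \<subseteq> {..<k} \<and>
        (replicate p 0 @ replicate n 1) @ Suc m # map wr w = map rd w @ f)"
    unfolding k_def using queue_run_iff[of m c "number k init"] W run unfolding k_def by blast
  also have "\<dots> \<longleftrightarrow> (\<exists>t. ((\<lambda>_. 0)(0 := n), t) \<in> exec c)"
  proof
    assume "\<exists>w f p. matches (subst (block m) c) w \<and> set f \<subseteq> {..<k} \<and>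
        (replicate p 0 @ replicate n 1) @ Suc m # map wr w = map rd w @ f"
    then obtain w f p where w: "matches (subst (block m) c) w" and
      eq: "(replicate p 0 @ replicate n 1) @ Suc m # map wr w = map rd w @ f" by blast
    from matches_subst_elim[OF w] obtain as ws where as: "matches c as"
      "list_all2 (\<lambda>a. matches (block m a)) as ws" "w = concat ws" by blast
    from blocks_sound[OF as(2) matches_reg[OF as(1)] eq[unfolded as(3)] letters]
    show "\<exists>t. ((\<lambda>_. 0)(0 := n), t) \<in> exec c"
      unfolding store den_eq_path using as(1) by blast
  next
    assume "\<exists>t. ((\<lambda>_. 0)(0 := n), t) \<in> exec c"
    then obtain t as where as: "matches c as" "((\<lambda>_. 0)(0 := n), t) \<in> path act as"
      unfolding den_eq_path by blast
    \<comment> \<open>One blank for each instruction of the run is enough.\<close>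
    let ?X = "replicate (length as) 0 @ replicate n 1"
    have count: "length as \<le> count_list ?X 0" by (simp add: count_list_replicate)
    from blocks_complete[OF _ matches_reg[OF as(1)] letters count, of t] as(2)
    obtain ws f where "list_all2 (\<lambda>a. matches (block m a)) as ws"
      "?X @ Suc m # map wr (concat ws) = map rd (concat ws) @ f" "set f \<subseteq> {..Suc m}"
      unfolding store by blast
    moreover from this have "matches (subst (block m) c) (concat ws)"
      by (intro matches_subst_intro[OF as(1)])
    ultimately show "\<exists>w f p. matches (subst (block m) c) w \<and> set f \<subseteq> {..<k} \<and>
        (replicate p 0 @ replicate n 1) @ Suc m # map wr w = map rd w @ f"
      by (intro exI[of _ "concat ws"] exI[of _ f] exI[of _ "length as"]) (auto simp: k_def)
  qed
  finally show ?thesis by (simp add: k_def init_def)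
qed

section \<open>Realization by vectors and a diagonal matrix\<close>

primrec triple_vec :: "int \<times> int \<times> int \<Rightarrow> int vec" where
  "triple_vec (x, yz) = vec 3 (\<lambda>i. if i = 0 then x else if i = 1 then fst yz else snd yz)"

text \<open>Only digits multiply; \<open>Transfer\<close> and \<open>Cancel\<close> use exponent 0
  and are plain translations.\<close>

primrec label :: "atom \<Rightarrow> nat \<times> int vec" where
  "label (Digit a b) = (1, triple_vec (int a, int b, 0))"
| "label Transfer = (0, triple_vec (0, - 1, 1))"
| "label Cancel = (0, triple_vec (- 1, 0, - 1))"

definition diag :: "nat \<Rightarrow> nat mat" where
  "diag k = mat 3 3 (\<lambda>(i, j). if i = j then if i = 2 then 1 else k else 0)"

lemma triple_vec_carrier: "triple_vec s \<in> carrier_vec 3"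
  by (cases s) simp

lemma diag_carrier: "diag k \<in> carrier_mat 3 3"
  by (simp add: diag_def)

lemma less_3_iff: "i < (3::nat) \<longleftrightarrow> i = 0 \<or> i = 1 \<or> i = 2"
  by auto

lemma diag_mult_triple_vec:
  "map_mat int (diag k) *\<^sub>v triple_vec (x, y, z) = triple_vec (int k * x, int k * y, z)"
proof (rule eq_vecI)
  fix i assume "i < dim_vec (triple_vec (int k * x, int k * y, z))"
  then have "i = 0 \<or> i = 1 \<or> i = 2" by (simp add: less_3_iff)
  then show "(map_mat int (diag k) *\<^sub>v triple_vec (x, y, z)) $ i = triple_vec (int k * x, int k * y, z) $ i"
    by (auto simp: diag_def scalar_prod_def numeral_3_eq_3)
qed (simp add: diag_def)

lemma triple_vec_add:
  "triple_vec (x, y, z) + triple_vec (a, b, c) = triple_vec (x + a, y + b, z + c)"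
  by (intro eq_vecI) auto

lemma affine_rel_label:
  "(triple_vec s, t) \<in> affine_rel 3 (diag k) (label a) \<longleftrightarrow>
    (\<exists>s'. t = triple_vec s' \<and> (s, s') \<in> triple_rel k a)"
proof -
  obtain x y z where s: "s = (x, y, z)" by (metis prod_cases3)
  have pow1: "diag k ^\<^sub>m Suc 0 = diag k"
    using diag_carrier by (simp add: left_mult_one_mat[OF diag_carrier] diag_def)
  have pow0: "map_mat int (diag k ^\<^sub>m 0) *\<^sub>v triple_vec s = triple_vec s"
  proof -
    have "map_mat int (diag k ^\<^sub>m 0) = 1\<^sub>m 3" by (rule eq_matI) (auto simp: diag_def)
    then show ?thesis using triple_vec_carrier by simp
  qed
  show ?thesis
    using triple_vec_carrier[of s] pow0
    by (cases a) (auto simp: affine_rel_def s pow1 diag_mult_triple_vec triple_vec_add simp del: triple_vec.simps)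
qed

lemma monogenic_rewriting:
  fixes rs :: "(trm \<times> trm) list"
  assumes "\<And>l r. (l, r) \<in> set rs \<Longrightarrow> vars l \<union> vars r \<subseteq> {2..}"
  obtains V :: "nat affine_vass" and p q m where "affine_zvass V" "monogenic V"
    "\<And>s. (p, triple_vec s) \<in> configs V" "\<And>s. (q, triple_vec s) \<in> configs V"
    "\<And>n. reaches V (p, triple_vec (0, int (number (m + 2) (replicate n 1 @ [Suc m])), 0))
        (q, triple_vec (0, 0, 0)) \<longleftrightarrow> (n, 0) \<in> (rewrite_rel rs)\<^sup>*"
proof -
  from rewrite_program[OF assms] obtain c where
    c: "\<And>n. (\<exists>t. ((\<lambda>_. 0)(0 := n), t) \<in> exec c) \<longleftrightarrow> (n, 0) \<in> (rewrite_rel rs)\<^sup>*" by blast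
  have "finite (reg ` set_rx c)" by (induction c) (auto simp: image_Un)
  then obtain m0 where m0: "\<forall>r\<in>reg ` set_rx c. r < m0"
    unfolding finite_nat_set_iff_bounded by blast
  \<comment> \<open>The successor ensures \<open>0 < m\<close>, so that the letter 1 of the input
    belongs to the alphabet even if the program mentions no register.\<close>
  define m where "m = Suc m0"
  have m: "reg a < m" if "a \<in> set_rx c" for a
    using m0 that by (auto simp: m_def less_SucI)
  have label_carrier: "snd (label a) \<in> carrier_vec 3" for a
    by (cases a) (simp_all del: triple_vec.simps add: triple_vec_carrier)
  \<comment> \<open>The embedding yields some triple with the target vector; injectivity identifies
    it with the given one.\<close>
  have inj: "s = s'" if "triple_vec s = triple_vec s'" for s s'
  proof -
    have "triple_vec s $ i = triple_vec s' $ i" for i using that by simp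
    from this[of 0] this[of 1] this[of 2] show ?thesis by (cases s; cases s') auto
  qed
  show thesis
  proof (rule monogenic_of_rx[OF diag_carrier[of "m + 2"] label_carrier, where r = "queue_rx m c"])
    fix V :: "nat affine_vass" and p q
    assume V: "affine_zvass V" "monogenic V" "vass_dim V = 3" "p \<in> vass_states V" "q \<in> vass_states V"
    assume reach: "\<And>u v. u \<in> carrier_vec 3 \<Longrightarrow> reaches V (p, u) (q, v) \<longleftrightarrow>
       (u, v) \<in> den (\<lambda>a. affine_rel 3 (diag (m + 2)) (label a)) (queue_rx m c)"
    have reach_iff: "reaches V (p, triple_vec s) (q, triple_vec t) \<longleftrightarrow> (s, t) \<in> den (triple_rel (m + 2)) (queue_rx m c)"
      for s t
      unfolding reach[OF triple_vec_carrier]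
      using den_embed[of triple_vec _ "triple_rel (m + 2)", OF affine_rel_label] inj by metis
    have "0 < m" by (simp add: m_def)
    have "reaches V (p, triple_vec (0, int (number (m + 2) (replicate n 1 @ [Suc m])), 0))
          (q, triple_vec (0, 0, 0)) \<longleftrightarrow> (n, 0) \<in> (rewrite_rel rs)\<^sup>*" for n
      unfolding reach_iff c[symmetric] by (rule queue_correct) (use m \<open>0 < m\<close> in auto)
    moreover have "(p, triple_vec s) \<in> configs V" "(q, triple_vec s) \<in> configs V" for s
      using V triple_vec_carrier by (auto simp: configs_def)
    ultimately show thesis using that[OF V(1,2)] by blast
  qed
qed

section \<open>Computability of the reduction\<close>

definition computable :: "nat \<Rightarrow> (nat list \<Rightarrow> nat) \<Rightarrow> bool" where
  "computable n F \<longleftrightarrow> (\<exists>f. \<forall>xs. length xs = n \<longrightarrow> rec_eval f xs (F xs))"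

lemma computable_nth: "i < n \<Longrightarrow> computable n (\<lambda>xs. xs ! i)"
  unfolding computable_def by (intro exI[of _ "Proj i"]) (auto intro: rec_eval.proj)

lemma computable_Suc:
  assumes "computable n F"
  shows "computable n (\<lambda>xs. Suc (F xs))"
proof -
  from assms obtain f where "\<forall>xs. length xs = n \<longrightarrow> rec_eval f xs (F xs)"
    unfolding computable_def by blast
  then show ?thesis
    unfolding computable_def
    by (intro exI[of _ "Comp Succ [f]"]) (auto intro!: rec_eval.comp[where ys = "[_]"] rec_eval.succ)
qed

lemma computable_const: "computable n (\<lambda>_. c)"
proof (induction c)
  case 0
  show ?case unfolding computable_def by (auto intro: rec_eval.zero)
qed (rule computable_Suc)

lemma computable_comp1:
  assumes "computable 1 (\<lambda>xs. H (xs ! 0))" "computable n F"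
  shows "computable n (\<lambda>xs. H (F xs))"
proof -
  from assms obtain h f where h: "\<forall>xs. length xs = 1 \<longrightarrow> rec_eval h xs (H (xs ! 0))"
    and f: "\<forall>xs. length xs = n \<longrightarrow> rec_eval f xs (F xs)"
    unfolding computable_def by blast
  have "rec_eval h [x] (H x)" for x using h[rule_format, of "[x]"] by simp
  with f show ?thesis
    unfolding computable_def
    by (intro exI[of _ "Comp h [f]"]) (auto intro!: rec_eval.comp[where ys = "[_]"])
qed

lemma computable_comp2:
  assumes "computable 2 (\<lambda>xs. H (xs ! 0) (xs ! 1))" "computable n F" "computable n G"
  shows "computable n (\<lambda>xs. H (F xs) (G xs))"
proof -
  from assms obtain h f g where h: "\<forall>xs. length xs = 2 \<longrightarrow> rec_eval h xs (H (xs ! 0) (xs ! 1))"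
    and f: "\<forall>xs. length xs = n \<longrightarrow> rec_eval f xs (F xs)"
    and g: "\<forall>xs. length xs = n \<longrightarrow> rec_eval g xs (G xs)"
    unfolding computable_def by blast
  have "rec_eval h [x, y] (H x y)" for x y using h[rule_format, of "[x, y]"] by simp
  with f g show ?thesis
    unfolding computable_def
    by (intro exI[of _ "Comp h [f, g]"]) (auto intro!: rec_eval.comp[where ys = "[_, _]"])
qed

lemma computable_rec:
  assumes "computable n B" "computable (n + 2) (\<lambda>xs. S (xs ! 0) (xs ! 1) (drop 2 xs))"
  shows "computable (Suc n) (\<lambda>xs. rec_nat (B (tl xs)) (\<lambda>m y. S m y (tl xs)) (hd xs))"
proof -
  from assms obtain b s where b: "\<forall>xs. length xs = n \<longrightarrow> rec_eval b xs (B xs)"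
    and s: "\<forall>xs. length xs = n + 2 \<longrightarrow> rec_eval s xs (S (xs ! 0) (xs ! 1) (drop 2 xs))"
    unfolding computable_def by blast
  have "rec_eval (PrimRec b s) (k # xs) (rec_nat (B xs) (\<lambda>m y. S m y xs) k)" if "length xs = n" for k xs
  proof (induction k)
    case 0
    show ?case using b that by (auto intro: rec_eval.prim_rec_0)
  next
    case (Suc k)
    show ?case
      using rec_eval.prim_rec_Suc[OF Suc] s[rule_format, of "k # _ # xs"] that by simp
  qed
  then show ?thesis
    unfolding computable_def by (intro exI[of _ "PrimRec b s"]) (auto simp: length_Suc_conv)
qed

lemma computable_cong: "computable n F \<Longrightarrow> (\<And>xs. length xs = n \<Longrightarrow> F xs = G xs) \<Longrightarrow> computable n G"
  unfolding computable_def by metis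

lemma computable_add: "computable n F \<Longrightarrow> computable n G \<Longrightarrow> computable n (\<lambda>xs. F xs + G xs)"
proof (erule (1) computable_comp2[rotated])
  have "computable (Suc 1) (\<lambda>xs. rec_nat (tl xs ! 0) (\<lambda>m y. Suc y) (hd xs))"
    by (rule computable_rec[where B = "\<lambda>xs. xs ! 0" and S = "\<lambda>m y xs. Suc y"])
      (auto intro!: computable_nth computable_Suc)
  then have "computable 2 (\<lambda>xs. rec_nat (tl xs ! 0) (\<lambda>m y. Suc y) (hd xs))"
    by (simp add: numeral_2_eq_2)
  then show "computable 2 (\<lambda>xs. xs ! 0 + xs ! 1)"
  proof (rule computable_cong)
    fix xs :: "nat list"
    assume "length xs = 2"
    then obtain k x where xs: "xs = [k, x]" by (auto simp: numeral_2_eq_2 length_Suc_conv)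
    have "rec_nat x (\<lambda>m y. Suc y) k = k + x" by (induction k) auto
    then show "rec_nat (tl xs ! 0) (\<lambda>m y. Suc y) (hd xs) = xs ! 0 + xs ! 1" by (simp add: xs)
  qed
qed

text \<open>Primitive recursion without parameters, stated for a function given by a recurrence so
  that no explicit recursor has to be exhibited.\<close>

lemma computable_iterate:
  assumes "computable 2 (\<lambda>xs. S (xs ! 0) (xs ! 1))" "F 0 = c" "\<And>k. F (Suc k) = S k (F k)"
    and G: "computable n G"
  shows "computable n (\<lambda>xs. F (G xs))"
proof (rule computable_comp1[OF _ G])
  have "computable (Suc 0) (\<lambda>xs. rec_nat c (\<lambda>m y. S m y) (hd xs))"
    by (rule computable_rec[where B = "\<lambda>xs. c" and S = "\<lambda>m y xs. S m y"])
      (use assms(1) in \<open>auto intro!: computable_const simp: numeral_2_eq_2\<close>)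
  then have "computable 1 (\<lambda>xs. rec_nat c (\<lambda>m y. S m y) (hd xs))" by simp
  then show "computable 1 (\<lambda>xs. F (xs ! 0))"
  proof (rule computable_cong)
    fix xs :: "nat list"
    assume "length xs = 1"
    then obtain k where xs: "xs = [k]" by (auto simp: length_Suc_conv)
    have "rec_nat c (\<lambda>m y. S m y) k = F k" by (induction k) (auto simp: assms)
    then show "rec_nat c (\<lambda>m y. S m y) (hd xs) = F (xs ! 0)" by (simp add: xs)
  qed
qed

lemma computable_prod_encode:
  assumes "computable n F" "computable n G"
  shows "computable n (\<lambda>xs. prod_encode (F xs, G xs))"
proof -
  have tri: "computable k T \<Longrightarrow> computable k (\<lambda>xs. triangle (T xs))" for k T
    by (rule computable_iterate[where S = "\<lambda>m y. y + Suc m" and c = 0])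
      (auto intro!: computable_add computable_nth computable_Suc)
  show ?thesis
    unfolding prod_encode_def by (auto intro!: computable_add tri assms)
qed

text \<open>The products in the reduction have a fixed factor, the base \<open>k\<close> or the 2 in
  \<open>int_encode\<close>, so repeated addition of a constant suffices.\<close>

lemma computable_affine:
  assumes "computable n F"
  shows "computable n (\<lambda>xs. F xs * a + b)"
proof (rule computable_iterate[where F = "\<lambda>x. x * a + b", OF _ _ _ assms])
  show "computable 2 (\<lambda>xs. (\<lambda>m y. y + a) (xs ! 0) (xs ! 1))"
    by (auto intro!: computable_add computable_nth computable_const)
qed auto

lemma computable_number:
  assumes "computable n F"
  shows "computable n (\<lambda>xs. number k (replicate (F xs) 1 @ [d]))"
proof -
  have "computable n (\<lambda>xs. number k (replicate (F xs) 1))"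
  proof (rule computable_iterate[where F = "\<lambda>x. number k (replicate x 1)", OF _ _ _ assms])
    show "computable 2 (\<lambda>xs. (\<lambda>m y. y * k + 1) (xs ! 0) (xs ! 1))"
      by (auto intro!: computable_affine[where b = 1, simplified] computable_nth)
    show "number k (replicate (Suc m) 1) = number k (replicate m 1) * k + 1" for m
      by (metis number_snoc replicate_Suc replicate_append_same)
  qed simp
  from computable_affine[OF this, of k d] show ?thesis by simp
qed

lemma computable_query: "computable n F \<Longrightarrow> computable n (\<lambda>xs. query (F xs))"
  unfolding query_def by (intro computable_Suc computable_prod_encode computable_const)

lemma encode_vec_triple_vec:
  "encode_vec (triple_vec (x, y, z)) = list_encode [int_encode x, int_encode y, int_encode z]"
proof -
  have "list_of_vec (triple_vec (x, y, z)) = [x, y, z]"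
    by (simp add: list_of_vec_map numeral_3_eq_3)
  then show ?thesis by (simp add: encode_vec_def)
qed

text \<open>The summand 0 gives the right-hand side the shape that \<open>computable_affine\<close>
  expects.\<close>

lemma int_encode_int: "int_encode (int n) = n * 2 + 0"
  by (simp add: int_encode_def sum_encode_def)

lemma computable_encode_config_pair:
  assumes "computable n F"
  shows "computable n (\<lambda>xs. encode_config_pair
    ((p, triple_vec (0, int (number k (replicate (F xs) 1 @ [d])), 0)), c))"
  unfolding encode_config_pair_def encode_config_def prod.case encode_vec_triple_vec
    list_encode.simps int_encode_int
  by (intro computable_prod_encode computable_Suc computable_const computable_affine
      computable_number assms)

section \<open>Diagonalization\<close>

text \<open>At its own code, a decision procedure \<open>g\<close> would answer 0 exactly if
  \<open>P\<close> fails there, whereas \<open>P\<close> holds there exactly if \<open>g\<close>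
  answers 0. The values of \<open>P\<close> at numbers that are not codes are arbitrary.\<close>

lemma self_evaluation_undecidable:
  assumes "\<And>f. P (rec_code f) \<longleftrightarrow> rec_eval f [rec_code f] 0"
  shows "\<not> (\<exists>g. \<forall>n. rec_eval g [n] (if P n then 1 else 0))"
proof
  assume "\<exists>g. \<forall>n. rec_eval g [n] (if P n then 1 else 0)"
  then obtain g where "rec_eval g [rec_code g] (if P (rec_code g) then 1 else 0)" by blast
  with assms[of g] show False
    by (metis rec_eval_functional zero_neq_one)
qed

theorem theorem7p4:
  shows "\<not> decidable_problem encode_instance monogenic_instances (\<lambda>(V, c, c'). reaches V c c') \<and>
    (\<exists>V :: nat affine_vass. affine_zvass V \<and> monogenic V \<and>
       \<not> decidable_problem encode_config_pair (configs V \<times> configs V) (\<lambda>(c, c'). reaches V c c'))"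
proof -
  from monogenic_rewriting[OF vars_rules] obtain V :: "nat affine_vass" and p q m where
    V: "affine_zvass V" "monogenic V" and
    configs: "\<And>s. (p, triple_vec s) \<in> configs V" "\<And>s. (q, triple_vec s) \<in> configs V" and
    reach: "\<And>n. reaches V (p, triple_vec (0, int (number (m + 2) (replicate n 1 @ [Suc m])), 0))
        (q, triple_vec (0, 0, 0)) \<longleftrightarrow> (n, 0) \<in> (rewrite_rel rules)\<^sup>*" by blast
  define inst where "inst n = ((p, triple_vec (0, int (number (m + 2) (replicate (query n) 1 @ [Suc m])), 0)),
    (q, triple_vec (0, 0, 0)))" for n
  have inst: "inst n \<in> configs V \<times> configs V" for n
    unfolding inst_def using configs by blast
  define P where "P n \<longleftrightarrow> (\<lambda>(c, c'). reaches V c c') (inst n)" for n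
  have P: "P (rec_code f) \<longleftrightarrow> rec_eval f [rec_code f] 0" for f
    unfolding P_def inst_def prod.case reach by (rule rewrite_query_iff)
  have enc: "computable 1 (\<lambda>xs. encode_config_pair (inst (xs ! 0)))"
    unfolding inst_def by (intro computable_encode_config_pair computable_query computable_nth) simp
  \<comment> \<open>Both claims are many-one reductions from \<open>P\<close>; they differ only in
    the computable encoding \<open>e\<close> of the instances.\<close>
  have undecidable: "\<not> (\<forall>n. rec_eval f [e [n]] (if P n then 1 else 0))" if e: "computable 1 e" for e f
  proof
    assume f: "\<forall>n. rec_eval f [e [n]] (if P n then 1 else 0)"
    from e obtain g where "\<And>xs. length xs = 1 \<Longrightarrow> rec_eval g xs (e xs)"
      unfolding computable_def by blast
    then have "rec_eval (Comp f [g]) [n] (if P n then 1 else 0)" for n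
      using f by (intro rec_eval.comp[where ys = "[e [n]]"]) auto
    with self_evaluation_undecidable[of P, OF P] show False by blast
  qed
  have "\<not> decidable_problem encode_config_pair (configs V \<times> configs V) (\<lambda>(c, c'). reaches V c c')"
  proof
    assume "decidable_problem encode_config_pair (configs V \<times> configs V) (\<lambda>(c, c'). reaches V c c')"
    then obtain f where "\<And>x. x \<in> configs V \<times> configs V \<Longrightarrow>
      rec_eval f [encode_config_pair x] (if (\<lambda>(c, c'). reaches V c c') x then 1 else 0)"
      unfolding decidable_problem_def by blast
    then have "rec_eval f [encode_config_pair (inst n)] (if P n then 1 else 0)" for n
      unfolding P_def using inst by blast
    with undecidable[OF enc, of f] show False by simp
  qed
  moreover have "\<not> decidable_problem encode_instance monogenic_instances (\<lambda>(V, c, c'). reaches V c c')"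
  proof
    assume "decidable_problem encode_instance monogenic_instances (\<lambda>(V, c, c'). reaches V c c')"
    then obtain f where f: "\<And>x. x \<in> monogenic_instances \<Longrightarrow>
      rec_eval f [encode_instance x] (if (\<lambda>(V, c, c'). reaches V c c') x then 1 else 0)"
      unfolding decidable_problem_def by blast
    have "(V, inst n) \<in> monogenic_instances" for n
      using V inst[of n] by (cases "inst n") (auto simp: monogenic_instances_def)
    from f[OF this] have "rec_eval f [encode_instance (V, inst n)] (if P n then 1 else 0)" for n
      by (simp add: P_def)
    \<comment> \<open>Since \<open>V\<close> is fixed, its code is a constant, and the instances for
      the fixed system also serve the general problem.\<close>
    moreover have "computable 1 (\<lambda>xs. encode_instance (V, inst (xs ! 0)))"
      unfolding encode_instance_def prod.case by (intro computable_prod_encode computable_const enc)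
    ultimately show False
      using undecidable[of "\<lambda>xs. encode_instance (V, inst (xs ! 0))" f] by simp
  qed
  ultimately show ?thesis using V by blast
qed

end
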